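(* Let $m,n\ge 1$ be integers with $h=n-m\ge 0$. In the relative Kauffman bracket skein module of $D^2\times I$ with $2(m+n)$ boundary points, $$L(m,n)=\sum_{k=0}^{m}P_{k,m-k,h}\,T_{k,m-k,h}+\text{Remainder},\qquad P_{k,m-k,h}=A^{nm-2(k+h)k}{m\brack k}_{A^{-4}},$$ where $T_{k,m-k,h}$ is the Catalan state with $2k$ positive diagonal arcs, $2(m-k)$ negative diagonal arcs and $h$ vertical arcs, and the Remainder is a linear combination, with coefficients in $\mathbb Z[A^{\pm1}]$, of realizable Catalan states each of which has at least one return.
   Context: $P\cong D^2$ is a rectangle with $2(m+n)$ marked boundary points: $n$ on the top side and $n$ on the bottom side (numbered left to right), and $m$ on the left side and $m$ on the right side (numbered top to bottom). A Catalan state is a crossingless connection of the marked points (system of $m+n$ disjoint arcs in $P$ up to isotopy fixing the boundary; equivalently a noncrossing perfect matching of the marked points). $\mathfrak{Cat}_{m,n}$ is the set of Catalan states. A return is an arc with both endpoints on the same side of $P$. The relative Kauffman bracket skein module of $P\times I$ with these points is a free $\mathbb Z[A^{\pm1}]$-module with basis $\mathfrak{Cat}_{m,n}$. The lattice crossing $L(m,n)$ is the tangle diagram consisting of $m$ horizontal segments (left point $i$ to right point $i$) and $n$ vertical segments (top point $j$ to bottom point $j$) with $mn$ crossings, all of the same type (all vertical strands pass over all horizontal strands). A Kauffman state $s\in\mathcal S_{m,n}$ assigns a positive or negative marker to each crossing: the positive marker smooths the crossing by joining its top end with its right end and its left end with its bottom end; the negative marker joins its top end with its left end and its right end with its bottom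 end. Let $p(s)$, $n(s)$ be the numbers of positive and negative markers, $|s|$ the number of closed components after smoothing all crossings, and $K(s)\in\mathfrak{Cat}_{m,n}$ the Catalan state obtained after deleting closed components. In the skein module, $$L(m,n)=\sum_{s\in\mathcal S_{m,n}}A^{p(s)-n(s)}(-A^2-A^{-2})^{|s|}K(s).$$ A Catalan state $C$ is realizable if $C=K(s)$ for some $s\in\mathcal S_{m,n}$. A positive diagonal arc joins the left side to the top side, or the right side to the bottom side; a negative diagonal arc joins the top side to the right side, or the left side to the bottom side; a vertical arc joins the top side to the bottom side. $T_{k,m-k,h}$ is the (unique) Catalan state with no returns having $k$ arcs joining left to top, $k$ arcs joining right to bottom, $m-k$ arcs joining top to right, $m-k$ arcs joining left to bottom, and $h$ arcs joining top to bottom. The $q$-integers are $[m]_q=1+q+\dots+q^{m-1}$, $[m]_q!=[1]_q[2]_q\cdots[m]_q$ (with $[0]_q!=1$), and ${m\brack k}_q=\dfrac{[m]_q!}{[k]_q!\,[m-k]_q!}$. *)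

theory Defs
  imports
    "HOL-Library.FuncSet"
    "HOL-Library.Poly_Mapping"
    "HOL-Computational_Algebra.Polynomial"
begin

section \<open>Laurent polynomials and Gaussian binomial coefficients\<close>

text \<open>The ring of integral Laurent polynomials in one indeterminate \<open>A\<close> is the monoid algebra
  of the additive group of integers over the integers; the product of \<^type>\<open>poly_mapping\<close> is
  convolution.\<close>

type_synonym laurent = "int \<Rightarrow>\<^sub>0 int"

definition A_pow :: "int \<Rightarrow> laurent" where
  "A_pow e = Poly_Mapping.single e 1"

lemma A_pow_add: "A_pow (d + e) = A_pow d * A_pow e"
  by (simp add: A_pow_def mult_single)

lemma A_pow_0: "A_pow 0 = 1"
  by (simp add: A_pow_def)

definition q_int :: "nat \<Rightarrow> int poly" where
  "q_int m = (\<Sum>i<m. monom 1 i)"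

definition q_fact :: "nat \<Rightarrow> int poly" where
  "q_fact m = (\<Prod>i=1..m. q_int i)"

text \<open>The quotient is formed in the ring of integral polynomials in \<open>q\<close>; lemma \<open>q_binomial_exact\<close>
  below shows that the division leaves no remainder.\<close>

definition q_binomial :: "nat \<Rightarrow> nat \<Rightarrow> int poly" where
  "q_binomial m k = q_fact m div (q_fact k * q_fact (m - k))"

definition eval_laurent :: "int poly \<Rightarrow> laurent \<Rightarrow> laurent" where
  "eval_laurent p x = poly (map_poly of_int p) x"

lemma q_int_add: "q_int (k + l) = q_int k + monom 1 k * q_int l"
  by (induction l) (simp_all add: q_int_def mult_monom algebra_simps)

lemma q_fact_Suc: "q_fact (Suc m) = q_int (Suc m) * q_fact m"
  by (simp add: q_fact_def mult.commute)

lemma q_fact_dvd: "q_fact k * q_fact l dvd q_fact (k + l)"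
proof (induction "k + l" arbitrary: k l rule: less_induct)
  case less
  show ?case
  proof (cases "k = 0 \<or> l = 0")
    case True
    then show ?thesis by (auto simp: q_fact_def)
  next
    case False
    then obtain a b where ab: "k = Suc a" "l = Suc b"
      by (metis not0_implies_Suc)
    have "q_fact a * q_fact (Suc b) dvd q_fact (Suc (a + b))"
      using less[of a "Suc b"] ab by simp
    then have 1: "q_fact k * q_fact l dvd q_int k * q_fact (Suc (a + b))"
      unfolding ab q_fact_Suc[of a] mult.assoc by (rule mult_dvd_mono[OF dvd_refl])
    have "q_fact (Suc a) * q_fact b dvd q_fact (Suc (a + b))"
      using less[of "Suc a" b] ab by simp
    then have "q_int l * (q_fact (Suc a) * q_fact b) dvd q_int l * q_fact (Suc (a + b))"
      by (rule mult_dvd_mono[OF dvd_refl])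
    then have 2: "q_fact k * q_fact l dvd q_int l * q_fact (Suc (a + b))"
      unfolding ab q_fact_Suc[of b] by (simp add: mult_ac)
    have "q_fact (k + l) = q_int (k + l) * q_fact (Suc (a + b))"
      using q_fact_Suc[of "Suc (a + b)"] ab by simp
    also have "\<dots> = q_int k * q_fact (Suc (a + b)) + monom 1 k * (q_int l * q_fact (Suc (a + b)))"
      by (simp add: q_int_add algebra_simps)
    finally show ?thesis
      using 1 2 by (simp add: dvd_add dvd_mult)
  qed
qed

lemma q_binomial_exact:
  "k \<le> m \<Longrightarrow> q_binomial m k * (q_fact k * q_fact (m - k)) = q_fact m"
  using q_fact_dvd[of k "m - k"] by (simp add: q_binomial_def)


section \<open>Catalan states\<close>

text \<open>A marked point is a side together with its number on that side: left to right on the top and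
  bottom sides, top to bottom on the left and right sides. Isotopy classes of crossingless
  connections are encoded as noncrossing perfect matchings, i.e. as sets of two-element sets of
  marked points.\<close>

datatype side = Top | Bottom | Left | Right

type_synonym point = "side \<times> nat"

type_synonym state = "point set set"

definition points :: "nat \<Rightarrow> nat \<Rightarrow> point set" where
  "points m n = {Top, Bottom} \<times> {1..n} \<union> {Left, Right} \<times> {1..m}"

text \<open>Clockwise position of a marked point on the boundary, starting at the top left corner.\<close>

fun boundary_pos :: "nat \<Rightarrow> nat \<Rightarrow> point \<Rightarrow> nat" where
  "boundary_pos m n (Top, j) = j"
| "boundary_pos m n (Right, i) = n + i"
| "boundary_pos m n (Bottom, j) = n + m + (n + 1 - j)"
| "boundary_pos m n (Left, i) = 2 * n + m + (m + 1 - i)"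

definition perfect_matching :: "nat \<Rightarrow> nat \<Rightarrow> state \<Rightarrow> bool" where
  "perfect_matching m n C \<longleftrightarrow>
     (\<forall>a\<in>C. a \<subseteq> points m n \<and> card a = 2) \<and> (\<forall>p\<in>points m n. \<exists>!a. a \<in> C \<and> p \<in> a)"

definition noncrossing :: "nat \<Rightarrow> nat \<Rightarrow> state \<Rightarrow> bool" where
  "noncrossing m n C \<longleftrightarrow>
     \<not> (\<exists>p p' r r'. {p, p'} \<in> C \<and> {r, r'} \<in> C \<and>
          boundary_pos m n p < boundary_pos m n r \<and>
          boundary_pos m n r < boundary_pos m n p' \<and>
          boundary_pos m n p' < boundary_pos m n r')"

definition Cat :: "nat \<Rightarrow> nat \<Rightarrow> state set" where
  "Cat m n = {C. perfect_matching m n C \<and> noncrossing m n C}"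

definition arcs_joining :: "side \<Rightarrow> side \<Rightarrow> state \<Rightarrow> point set set" where
  "arcs_joining S S' C = {a \<in> C. fst ` a = {S, S'}}"

definition has_return :: "state \<Rightarrow> bool" where
  "has_return C \<longleftrightarrow> (\<exists>S. arcs_joining S S C \<noteq> {})"

text \<open>\<open>T_state k l h\<close> has \<open>k\<close> left-top arcs, \<open>k\<close> right-bottom arcs, \<open>l\<close> top-right arcs,
  \<open>l\<close> left-bottom arcs and \<open>h\<close> vertical arcs, so its rectangle has \<open>k + l\<close> marked points on the
  left and right sides and \<open>k + l + h\<close> on the top and bottom sides. These numbers and the absence
  of returns determine the state.\<close>

definition T_state :: "nat \<Rightarrow> nat \<Rightarrow> nat \<Rightarrow> state" where
  "T_state k l h = (THE C. C \<in> Cat (k + l) (k + l + h) \<and> \<not> has_return C \<and>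
     card (arcs_joining Left Top C) = k \<and> card (arcs_joining Right Bottom C) = k \<and>
     card (arcs_joining Top Right C) = l \<and> card (arcs_joining Left Bottom C) = l \<and>
     card (arcs_joining Top Bottom C) = h)"


section \<open>Kauffman states of the lattice crossing\<close>

text \<open>The crossing \<open>(i, j)\<close> lies on the \<open>i\<close>-th horizontal strand from the top and on the \<open>j\<close>-th
  vertical strand from the left. The crossings cut the strands into segments: \<open>H i j\<close> is the
  segment of the \<open>i\<close>-th horizontal strand between the crossings \<open>(i, j)\<close> and \<open>(i, j + 1)\<close>, and
  \<open>V i j\<close> is the segment of the \<open>j\<close>-th vertical strand between the crossings \<open>(i, j)\<close> and
  \<open>(i + 1, j)\<close>. The outermost segments end at marked points.\<close>

datatype segment = H nat nat | V nat nat

definition segments :: "nat \<Rightarrow> nat \<Rightarrow> segment set" where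
  "segments m n = {H i j | i j. i \<in> {1..m} \<and> j \<in> {0..n}} \<union> {V i j | i j. i \<in> {0..m} \<and> j \<in> {1..n}}"

fun end_segment :: "nat \<Rightarrow> nat \<Rightarrow> point \<Rightarrow> segment" where
  "end_segment m n (Top, j) = V 0 j"
| "end_segment m n (Bottom, j) = V m j"
| "end_segment m n (Left, i) = H i 0"
| "end_segment m n (Right, i) = H i n"

datatype marker = Positive | Negative

type_synonym kstate = "nat \<times> nat \<Rightarrow> marker"

definition crossings :: "nat \<Rightarrow> nat \<Rightarrow> (nat \<times> nat) set" where
  "crossings m n = {1..m} \<times> {1..n}"

definition kauffman_states :: "nat \<Rightarrow> nat \<Rightarrow> kstate set" where
  "kauffman_states m n = crossings m n \<rightarrow>\<^sub>E UNIV"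

text \<open>The top, bottom, left and right ends at the crossing \<open>(i, j)\<close> belong to the segments
  \<open>V (i - 1) j\<close>, \<open>V i j\<close>, \<open>H i (j - 1)\<close> and \<open>H i j\<close>.\<close>

fun smoothing :: "marker \<Rightarrow> nat \<times> nat \<Rightarrow> (segment \<times> segment) set" where
  "smoothing Positive (i, j) = {(V (i - 1) j, H i j), (H i (j - 1), V i j)}"
| "smoothing Negative (i, j) = {(V (i - 1) j, H i (j - 1)), (H i j, V i j)}"

definition joins :: "nat \<Rightarrow> nat \<Rightarrow> kstate \<Rightarrow> (segment \<times> segment) set" where
  "joins m n s = (\<Union>c\<in>crossings m n. smoothing (s c) c)"

definition connected_segments :: "nat \<Rightarrow> nat \<Rightarrow> kstate \<Rightarrow> (segment \<times> segment) set" where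
  "connected_segments m n s =
     (joins m n s \<union> (joins m n s)\<inverse>)\<^sup>* \<inter> segments m n \<times> segments m n"

definition closed_components :: "nat \<Rightarrow> nat \<Rightarrow> kstate \<Rightarrow> segment set set" where
  "closed_components m n s =
     {X \<in> segments m n // connected_segments m n s. X \<inter> end_segment m n ` points m n = {}}"

definition K_state :: "nat \<Rightarrow> nat \<Rightarrow> kstate \<Rightarrow> state" where
  "K_state m n s = {{p, p'} | p p'. p \<in> points m n \<and> p' \<in> points m n \<and> p \<noteq> p' \<and>
     (end_segment m n p, end_segment m n p') \<in> connected_segments m n s}"

definition num_markers :: "nat \<Rightarrow> nat \<Rightarrow> marker \<Rightarrow> kstate \<Rightarrow> nat" where
  "num_markers m n \<mu> s = card {c \<in> crossings m n. s c = \<mu>}"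

definition realizable :: "nat \<Rightarrow> nat \<Rightarrow> state \<Rightarrow> bool" where
  "realizable m n C \<longleftrightarrow> C \<in> Cat m n \<and> (\<exists>s\<in>kauffman_states m n. C = K_state m n s)"


section \<open>The lattice crossing in the skein module\<close>

text \<open>The relative Kauffman bracket skein module is the free module on \<open>Cat m n\<close> over the Laurent
  polynomials. Its elements are finitely supported functions from states to Laurent polynomials
  whose support lies in \<open>Cat m n\<close>; \<open>scaled c C\<close> is the basis vector \<open>C\<close> with coefficient \<open>c\<close>.\<close>

type_synonym skein = "state \<Rightarrow>\<^sub>0 laurent"

definition scaled :: "laurent \<Rightarrow> state \<Rightarrow> skein" where
  "scaled c C = Poly_Mapping.single C c"

definition lattice_crossing :: "nat \<Rightarrow> nat \<Rightarrow> skein" where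
  "lattice_crossing m n =
     (\<Sum>s\<in>kauffman_states m n.
        scaled (A_pow (int (num_markers m n Positive s) - int (num_markers m n Negative s)) *
                (- A_pow 2 - A_pow (- 2)) ^ card (closed_components m n s))
          (K_state m n s))"

definition P_coeff :: "nat \<Rightarrow> nat \<Rightarrow> nat \<Rightarrow> laurent" where
  "P_coeff k l h =
     (let m = k + l; n = k + l + h in
       A_pow (int n * int m - 2 * (int k + int h) * int k) *
       eval_laurent (q_binomial m k) (A_pow (- 4)))"

end

theory Submission
  imports Defs
begin

text \<open>Sweep the crossings row by row. At each moment the smoothed part of the diagram matches the
  marked points of the top and left sides and the current ends of the strands; these
  \<open>2 * (m + n)\<close> slots are numbered by their clockwise position. The crossing \<open>(i, j)\<close> acts on the
  adjacent slots \<open>2 * n + i - j\<close> and \<open>2 * n + i - j + 1\<close>: a positive marker does nothing, and a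
  negative marker is a Temperley--Lieb generator, here called a turnback. Hence every
  \<open>K_state\<close> is a noncrossing matching, and the coefficient of a state is a sum over sweeps.

  Modulo states with returns, a negative marker directly followed by a positive one in a row creates
  a cup, which a Reidemeister move of type II pulls down to the bottom side. So a row contributes only
  through \<open>c\<close> positive markers followed by \<open>n - c\<close> negative ones. Starting from the matching
  \<open>arcs m n p q\<close>, all but two values of \<open>c\<close> (namely \<open>p\<close> and \<open>n - q\<close>) force a return, and these two
  lead to \<open>arcs m n p (q + 1)\<close> and \<open>arcs m n (p + 1) q\<close>. The weights of the resulting lattice paths
  satisfy the \<open>q\<close>-Pascal recursion.\<close>

section \<open>Turnbacks on slot matchings\<close>

text \<open>After \<open>p\<close> positive and \<open>q\<close> negative rows the vertical strand
  ends of the front lead, read from left to right, to the left side (\<open>p\<close> of them), to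
  the top (\<open>n - p - q\<close>) and to the right side (\<open>q\<close>); the incoming
  horizontal strand leads to the left. The first negative marker of a row joins the partners of two
  neighbouring slots, so it avoids a return only where the side changes, after \<open>p\<close> or
  after \<open>n - q\<close> positive markers; for \<open>q = 0\<close> the second choice is the
  all-positive row. The two choices weigh A^(2p-n) and A^(n-2q). Exchanging two consecutive rows of
  different type therefore matters: from (p,q), positive first gives A^(2p-2q+2) and negative first
  A^(2p-2q-2). The ratio A^(-4) is the argument of the Gaussian binomial, which counts lattice paths
  by area, and the path with all positive rows first supplies the prefactor A^(np-nq+2pq). Working
  modulo returns needs no quotient module: every sum is taken against a function \<open>w\<close> on
  matchings that vanishes on those with returns.\<close>

definition slot_matching :: "nat \<Rightarrow> (nat \<Rightarrow> nat) \<Rightarrow> bool" where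
  "slot_matching M f \<longleftrightarrow> (\<forall>x. f (f x) = x) \<and> (\<forall>x. f x \<noteq> x \<longleftrightarrow> x \<in> {1..M}) \<and>
     (\<forall>a b. \<not> (a < b \<and> b < f a \<and> f a < f b))"

definition bypass :: "nat \<Rightarrow> (nat \<Rightarrow> nat) \<Rightarrow> nat \<Rightarrow> nat" where
  "bypass z f v = (if v = z then f (Suc z) else if v = Suc z then f z else v)"

text \<open>If \<open>f z = Suc z\<close>, the turnback gives back \<open>f\<close> itself; the loop
  that closes is accounted for separately, in \<open>transfer\<close> and
  \<open>resolve\<close>.\<close>

definition turnback :: "nat \<Rightarrow> (nat \<Rightarrow> nat) \<Rightarrow> nat \<Rightarrow> nat" where
  "turnback z f x = (if x = z then Suc z else if x = Suc z then z else bypass z f (f x))"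

lemma turnback_simps [simp]:
  "turnback z f z = Suc z" "turnback z f (Suc z) = z"
  "x \<noteq> z \<Longrightarrow> x \<noteq> Suc z \<Longrightarrow> turnback z f x = bypass z f (f x)"
  by (simp_all add: turnback_def)

lemma slot_matching_invol: "slot_matching M f \<Longrightarrow> f (f x) = x"
  and slot_matching_fix: "slot_matching M f \<Longrightarrow> f x = x \<longleftrightarrow> x \<notin> {1..M}"
  and slot_matching_nc: "slot_matching M f \<Longrightarrow> \<not> (a < b \<and> b < f a \<and> f a < f b)"
  unfolding slot_matching_def by blast+

lemma slot_matching_eq_iff: "slot_matching M f \<Longrightarrow> f x = f y \<longleftrightarrow> x = y"
  by (metis slot_matching_invol)

lemma slot_matching_in:
  assumes "slot_matching M f" "x \<in> {1..M}"
  shows "f x \<in> {1..M}"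
  using assms slot_matching_fix[OF assms(1)] slot_matching_invol[OF assms(1)] by metis

lemma slot_matching_turnback:
  assumes f: "slot_matching M f" and z: "1 \<le> z" "Suc z \<le> M"
  shows "slot_matching M (turnback z f)"
  unfolding slot_matching_def
proof (intro conjI allI notI)
  note inv = slot_matching_invol[OF f] and eqi = slot_matching_eq_iff[OF f]
    and nc = slot_matching_nc[OF f]
  let ?g = "turnback z f"
  have ne: "f z \<noteq> z" "f (Suc z) \<noteq> Suc z"
    using z slot_matching_fix[OF f] by auto
  have inv': "f x = y \<longleftrightarrow> x = f y" for x y using inv by metis
  fix x
  consider "x = z" | "x = Suc z" | "x \<noteq> z" "x \<noteq> Suc z" "f x = z" | "x \<noteq> z" "x \<noteq> Suc z" "f x = Suc z"
    | "x \<noteq> z" "x \<noteq> Suc z" "f x \<noteq> z" "f x \<noteq> Suc z" by blast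
  note cs = this
  show "?g (?g x) = x"
  proof (cases rule: cs)
    case 3
    have "f (Suc z) \<noteq> z" using 3 inv by metis
    then show ?thesis using 3 ne inv[of x] inv by (simp add: bypass_def)
  next
    case 4
    have "f z \<noteq> Suc z" using 4 inv by metis
    then show ?thesis using 4 ne inv[of x] inv by (simp add: bypass_def)
  qed (auto simp: bypass_def inv)
  show "?g x \<noteq> x \<longleftrightarrow> x \<in> {1..M}"
  proof (cases rule: cs)
    case 3
    then have "x = f z" using inv by metis
    then show ?thesis using slot_matching_in[OF f, of z] 3 z by (simp add: bypass_def eqi)
  next
    case 4
    then have "x = f (Suc z)" using inv by metis
    then show ?thesis using slot_matching_in[OF f, of "Suc z"] 4 z by (simp add: bypass_def eqi)
  next
    case 5
    then show ?thesis using slot_matching_fix[OF f, of x] by (simp add: bypass_def)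
  qed (use z in auto)
  fix a b
  assume ab: "a < b \<and> b < ?g a \<and> ?g a < ?g b"
  have 1: "a \<noteq> z" "a \<noteq> Suc z" "b \<noteq> z" "b \<noteq> Suc z"
    using ab by (auto simp: turnback_def split: if_splits)
  have ab': "a < b" "b < bypass z f (f a)" "bypass z f (f a) < bypass z f (f b)"
    using ab 1 by auto
  have ffa: "f (f a) = a" "f (f b) = b" "f (f z) = z" "f (f (Suc z)) = Suc z" using inv by auto
  have "f a \<noteq> f b" using ab' eqi by auto
  \<comment> \<open>The cases record which of the two arcs were rerouted. If only one was, the
    crossing is traced back to a crossing in \<open>f\<close>. If both were, they form the same new
    arc, so \<open>b\<close> is the image of \<open>a\<close>, contrary to
    \<open>b < ?g a\<close>.\<close>
  then consider "f a \<noteq> z" "f a \<noteq> Suc z" "f b \<noteq> z" "f b \<noteq> Suc z"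
    | "f a = z" "f b \<noteq> z" "f b \<noteq> Suc z" | "f a = Suc z" "f b \<noteq> z" "f b \<noteq> Suc z"
    | "f b = z" "f a \<noteq> z" "f a \<noteq> Suc z" | "f b = Suc z" "f a \<noteq> z" "f a \<noteq> Suc z"
    | "f a = z" "f b = Suc z" | "f a = Suc z" "f b = z"  by metis
  then show False
  proof cases
    case 1 then show ?thesis using ab' nc[of a b] by (simp add: bypass_def)
  next
    case 2
    then have "a < b" "b < f (Suc z)" "f (Suc z) < f b" using ab' by (simp_all add: bypass_def)
    then show ?thesis using 2 1 nc[of a b] nc[of b "f (Suc z)"] nc[of "Suc z" b] ffa by simp
  next
    case 3
    then have "a < b" "b < f z" "f z < f b" using ab' by (simp_all add: bypass_def)
    then show ?thesis using 3 1 nc[of a b] nc[of b "f z"] nc[of z b] ffa by simp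
  next
    case 4
    then have "a < b" "b < f a" "f a < f (Suc z)" using ab' by (simp_all add: bypass_def)
    then show ?thesis using 4 1 nc[of a b] nc[of a "Suc z"] nc[of z a] ffa by simp
  next
    case 5
    then have "a < b" "b < f a" "f a < f z" using ab' by (simp_all add: bypass_def)
    then show ?thesis using 5 1 nc[of a b] nc[of a z] nc[of "Suc z" a] ffa by simp
  qed (use ab' ffa in \<open>auto simp: bypass_def\<close>)
qed

lemma turnback_keep:
  assumes f: "slot_matching M f" and "f x = y" "x \<notin> {z, Suc z}" "y \<notin> {z, Suc z}"
  shows "turnback z f x = y"
  using assms by (simp add: bypass_def)

section \<open>Runs of consecutive turnbacks\<close>

fun chain :: "nat \<Rightarrow> nat \<Rightarrow> (nat \<Rightarrow> nat) \<Rightarrow> nat \<Rightarrow> nat" where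
  "chain z 0 f = f"
| "chain z (Suc k) f = chain (z - 1) k (turnback z f)"

text \<open>The recursion peels off the first turnback, whereas the induction for
  \<open>chain_formula\<close> extends a run at its last one.\<close>

lemma chain_snoc: "chain z (Suc k) f = turnback (z - k) (chain z k f)"
proof (induction k arbitrary: z f)
  case (Suc k)
  have "chain z (Suc (Suc k)) f = chain (z - 1) (Suc k) (turnback z f)" by (rule chain.simps)
  also have "\<dots> = turnback (z - 1 - k) (chain (z - 1) k (turnback z f))" by (rule Suc.IH)
  finally show ?case by simp
qed simp

text \<open>The run joins the strands at \<open>z\<close> and \<open>Suc z\<close>, moves those at
  \<open>z - k\<close>, ..., \<open>z - 1\<close> up by two slots and leaves a cup at
  \<open>z - k\<close>. Here \<open>u\<close> is the former slot of the strand now at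
  \<open>y\<close>, \<open>v\<close> is its partner after the joining, and the last conditional
  moves that partner as well.\<close>

lemma chain_formula:
  assumes f: "slot_matching M f" and z: "f z \<noteq> Suc z" and k: "k < z" "Suc z \<le> M"
  shows "chain z (Suc k) f = (\<lambda>y. if y = z - k then Suc y else if y = Suc (z - k) then z - k
     else let u = (if z - k < y \<and> y \<le> Suc z then y - 2 else y); v = bypass z f (f u)
       in if z - k \<le> v \<and> v < z then v + 2 else v)"
  using k
proof (induction k)
  case 0
  then show ?case by (auto simp: fun_eq_iff turnback_def Let_def)
next
  case (Suc k)
  define g where "g = chain z (Suc k) f"
  define b where "b = z - Suc k"
  have b: "z - k = Suc b" "b < z" "1 \<le> b" using Suc.prems by (auto simp: b_def)
  note inv = slot_matching_invol[OF f] and eqi = slot_matching_eq_iff[OF f]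
  have ne: "f z \<noteq> z" "f (Suc z) \<noteq> Suc z" "f b \<noteq> b"
    using Suc.prems b slot_matching_fix[OF f] by auto
  have fz: "f x = z \<longleftrightarrow> x = f z" "f x = Suc z \<longleftrightarrow> x = f (Suc z)" "f x = b \<longleftrightarrow> x = f b" for x
    using inv by metis+
  have IH: "g = (\<lambda>y. if y = Suc b then Suc y else if y = Suc (Suc b) then Suc b
     else let u = (if Suc b < y \<and> y \<le> Suc z then y - 2 else y); v = bypass z f (f u)
       in if Suc b \<le> v \<and> v < z then v + 2 else v)"
    unfolding g_def using Suc.IH Suc.prems unfolding b(1) by simp
  have "chain z (Suc (Suc k)) f = turnback b g"
    by (simp only: chain_snoc g_def b_def)
  also have "\<dots> = (\<lambda>y. if y = b then Suc y else if y = Suc b then b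
     else let u = (if b < y \<and> y \<le> Suc z then y - 2 else y); v = bypass z f (f u)
       in if b \<le> v \<and> v < z then v + 2 else v)"
  proof
    fix y
    have gb: "g (Suc b) = Suc (Suc b)" by (simp add: IH)
    have gb': "g b = (let v = bypass z f (f b) in if Suc b \<le> v \<and> v < z then v + 2 else v)"
      using b by (simp add: IH)
    consider "y = b" | "y = Suc b" | "y = Suc (Suc b)" | "y \<noteq> b" "y \<noteq> Suc b" "y \<noteq> Suc (Suc b)" by blast
    then show "turnback b g y = (if y = b then Suc y else if y = Suc b then b
     else let u = (if b < y \<and> y \<le> Suc z then y - 2 else y); v = bypass z f (f u)
       in if b \<le> v \<and> v < z then v + 2 else v)"
    proof cases
      \<comment> \<open>The previous cup ended at this slot, so the new turnback hands it the strand
        from \<open>b\<close>; this is where the shift by two comes from.\<close>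
      case 3
      have "bypass z f (f b) \<noteq> b" using ne z inv b unfolding bypass_def
        by (metis n_not_Suc_n)
      then show ?thesis using 3 b gb gb' by (auto simp: bypass_def[of b] IH Let_def)
    next
      case 4
      define u where "u = (if Suc b < y \<and> y \<le> Suc z then y - 2 else y)"
      have u: "u = (if b < y \<and> y \<le> Suc z then y - 2 else y)" "u \<noteq> b"
        using 4 b by (auto simp: u_def)
      have gy: "g y = (let v = bypass z f (f u) in if Suc b \<le> v \<and> v < z then v + 2 else v)"
        using 4 by (simp add: IH u_def)
      have "bypass z f (f u) \<noteq> z" "bypass z f (f u) \<noteq> Suc z"
        using ne z inv unfolding bypass_def by metis+
      then show ?thesis
        using 4 b gb gy by (auto simp: bypass_def[of b] u(1)[symmetric] Let_def)
    qed auto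
  qed
  finally show ?case unfolding b_def .
qed

section \<open>Sums over sweeps modulo returns\<close>

fun down :: "nat \<Rightarrow> nat \<Rightarrow> nat list" where
  "down z 0 = []"
| "down z (Suc k) = z # down (z - 1) k"

lemma down_append: "down z (a + b) = down z a @ down (z - a) b"
  by (induction a arbitrary: z) simp_all

lemma set_down: "k \<le> z \<Longrightarrow> set (down z k) = {z - k<..z}"
proof (induction k arbitrary: z)
  case (Suc k)
  then have "set (down z (Suc k)) = insert z {z - 1 - k<..z - 1}" by simp
  also have "\<dots> = {z - Suc k<..z}" using Suc.prems by auto
  finally show ?case .
qed simp

text \<open>Here \<open>r\<close> rows are finished and \<open>d\<close> are still to come. A
  finished row adds a right end below the front, so the next row starts one slot higher.\<close>

fun sweep :: "nat \<Rightarrow> nat \<Rightarrow> nat \<Rightarrow> nat list" where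
  "sweep n r 0 = []"
| "sweep n r (Suc d) = down (2 * n + r) n @ sweep n (Suc r) d"

lemma set_sweep: "x \<in> set (sweep n r d) \<Longrightarrow> n + r < x \<and> x < 2 * n + r + d"
proof (induction d arbitrary: r)
  case (Suc d)
  show ?case
  proof (cases "x \<in> set (sweep n (Suc r) d)")
    case True
    then show ?thesis using Suc.IH[of "Suc r"] by simp
  next
    case False
    then show ?thesis using Suc.prems by (auto simp: set_down)
  qed
qed simp

definition loop_value :: laurent where
  "loop_value = - A_pow 2 - A_pow (- 2)"

text \<open>The final weight \<open>w\<close> is a parameter: an indicator extracts a single
  coefficient, and \<open>transfer_append\<close> puts the whole rest of a sweep in its
  place.\<close>

fun transfer :: "nat list \<Rightarrow> (nat \<Rightarrow> nat) \<Rightarrow> ((nat \<Rightarrow> nat) \<Rightarrow> laurent) \<Rightarrow> laurent" where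
  "transfer [] f w = w f"
| "transfer (z # zs) f w = A_pow 1 * transfer zs f w +
     A_pow (- 1) * (if f z = Suc z then loop_value else 1) * transfer zs (turnback z f) w"

lemma transfer_append: "transfer (ys @ zs) f w = transfer ys f (\<lambda>g. transfer zs g w)"
  by (induction ys arbitrary: f) simp_all

lemma transfer_eq_0:
  assumes "I f" "\<And>g z. I g \<Longrightarrow> z \<in> set zs \<Longrightarrow> I (turnback z g)" "\<And>g. I g \<Longrightarrow> w g = 0"
  shows "transfer zs f w = 0"
  using assms by (induction zs arbitrary: f) auto

text \<open>A turnback changes only arcs that end at its two slots, so an arc avoided by all
  remaining crossings is still present when \<open>w\<close> is evaluated.\<close>

lemma transfer_keep:
  assumes "slot_matching M f" "f x = y"
    "\<And>z. z \<in> set zs \<Longrightarrow> 1 \<le> z \<and> Suc z \<le> M \<and> x \<notin> {z, Suc z} \<and> y \<notin> {z, Suc z}"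
    "\<And>g. slot_matching M g \<Longrightarrow> g x = y \<Longrightarrow> w g = 0"
  shows "transfer zs f w = 0"
proof (rule transfer_eq_0[where I = "\<lambda>g. slot_matching M g \<and> g x = y"])
  fix g z assume "slot_matching M g \<and> g x = y" "z \<in> set zs"
  then show "slot_matching M (turnback z g) \<and> turnback z g x = y"
    using assms(3)[of z] turnback_keep[of M g x y z] slot_matching_turnback[of M g z] by blast
qed (use assms in auto)

lemma A_pow_mult [simp]: "A_pow d * A_pow e = A_pow (d + e)"
  by (simp add: A_pow_add)

lemma A_pow_mult_left: "A_pow d * (A_pow e * x) = A_pow (d + e) * x"
  by (simp only: A_pow_add mult.assoc)

text \<open>The Reidemeister move of type II: the cup at \<open>(x, x + 1)\<close> is pulled across the strand
  arriving at slot \<open>x + 2\<close>.\<close>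

lemma transfer_cup:
  assumes f: "slot_matching M f" "f x = Suc x" and x: "1 \<le> x" "Suc (Suc x) \<le> M"
  shows "transfer [Suc x, x] f w = w (turnback (Suc x) f)"
proof -
  note inv = slot_matching_invol[OF f(1)]
  have fx: "f (Suc x) = x" using f inv by metis
  define y where "y = f (Suc (Suc x))"
  have y: "f y = Suc (Suc x)" "y \<noteq> Suc (Suc x)" "y \<noteq> Suc x" "y \<noteq> x"
  proof -
    show "f y = Suc (Suc x)" by (simp add: y_def inv)
    show "y \<noteq> Suc (Suc x)" using x slot_matching_fix[OF f(1), of "Suc (Suc x)"] by (simp add: y_def)
    show "y \<noteq> Suc x" "y \<noteq> x" using \<open>f y = Suc (Suc x)\<close> fx f(2) by auto
  qed
  have 1: "turnback (Suc x) f x = y"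
    using y fx f by (simp add: turnback_def bypass_def y_def)
  \<comment> \<open>The Temperley-Lieb relation e_x e_(x+1) e_x = e_x, since \<open>f\<close>
    already contains the cup of e_x.\<close>
  have "turnback x (turnback (Suc x) f) = f"
  proof
    fix u
    consider "u = x" | "u = Suc x" | "u = Suc (Suc x)" | "u = y"
      | "u \<noteq> x" "u \<noteq> Suc x" "u \<noteq> Suc (Suc x)" "u \<noteq> y" by blast
    then show "turnback x (turnback (Suc x) f) u = f u"
    proof cases
      case 5
      then have "f u \<noteq> x" "f u \<noteq> Suc x" "f u \<noteq> Suc (Suc x)"
        using f(2) fx inv[of u] y_def by auto
      then show ?thesis using 5 by (simp add: turnback_def bypass_def)
    qed (use y fx f(2) y_def in \<open>auto simp: turnback_def bypass_def\<close>)
  qed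
  moreover have "turnback x f = f"
  proof
    fix u
    have "f u \<noteq> x" "f u \<noteq> Suc x" if "u \<noteq> x" "u \<noteq> Suc x"
      using that f(2) fx inv[of u] by auto
    then show "turnback x f u = f u"
      using f(2) fx by (auto simp: turnback_def bypass_def)
  qed
  ultimately have "transfer [Suc x, x] f w =
      A_pow 1 * (A_pow 1 * w f + A_pow (- 1) * loop_value * w f) +
      A_pow (- 1) * (A_pow 1 * w (turnback (Suc x) f) + A_pow (- 1) * w f)"
    using 1 y f(2) fx by simp
  \<comment> \<open>Every resolution except negative-then-positive ends in \<open>f\<close>, and the
    loop value is chosen so that these three coefficients cancel.\<close>
  also have "\<dots> = (A_pow 2 + loop_value + A_pow (- 2)) * w f + w (turnback (Suc x) f)"
    by (simp add: distrib_left distrib_right A_pow_mult_left A_pow_0 mult.assoc)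
  finally show ?thesis by (simp add: loop_value_def)
qed

text \<open>A cup crossed by a row reappears one slot higher: nothing touches it before slot
  \<open>Suc x\<close>, \<open>transfer_cup\<close> moves it, and the rest of the row acts on slots
  up to \<open>x\<close> only.\<close>

lemma cup_row:
  assumes f: "slot_matching M f" "f x = Suc x" and x: "z < x + k" "Suc (Suc x) \<le> Suc z" "k \<le> z" "Suc z \<le> M"
    "z - k < x" "0 < x"
    and w: "\<And>g. slot_matching M g \<Longrightarrow> g (Suc x) = Suc (Suc x) \<Longrightarrow> w g = 0"
  shows "transfer (down z k) f w = 0"
proof -
  \<comment> \<open>\<open>a\<close> crossings of the row precede the two at \<open>Suc x\<close>
    and \<open>x\<close>, and \<open>b\<close> follow them.\<close>
  define a b where "a = z - Suc x" and "b = k - a - 2"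
  have k: "k = a + (2 + b)" "z - a = Suc x" using x by (auto simp: a_def b_def)
  have split: "down z k = down z a @ [Suc x, x] @ down (x - 1) b"
    unfolding k down_append using k(2) x by (simp add: numeral_2_eq_2)
  have ab: "a \<le> z" "b \<le> x - 1" using x by (auto simp: a_def b_def)
  have "transfer (down z a) f (\<lambda>g. transfer [Suc x, x] g (\<lambda>g. transfer (down (x - 1) b) g w)) = 0"
  proof (rule transfer_keep[OF f])
    fix u assume "u \<in> set (down z a)"
    then show "1 \<le> u \<and> Suc u \<le> M \<and> x \<notin> {u, Suc u} \<and> Suc x \<notin> {u, Suc u}"
      using x ab k by (auto simp: set_down)
  next
    fix g assume g: "slot_matching M g" "g x = Suc x"
    have "transfer [Suc x, x] g (\<lambda>g. transfer (down (x - 1) b) g w)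
        = transfer (down (x - 1) b) (turnback (Suc x) g) w"
      by (rule transfer_cup[OF g]) (use x in auto)
    also have "\<dots> = 0"
    proof (rule transfer_keep[where x = "Suc x"])
      show "slot_matching M (turnback (Suc x) g)"
        by (rule slot_matching_turnback[OF g(1)]) (use x in auto)
      fix u assume "u \<in> set (down (x - 1) b)"
      then show "1 \<le> u \<and> Suc u \<le> M \<and> Suc x \<notin> {u, Suc u} \<and> Suc (Suc x) \<notin> {u, Suc u}"
        using x ab k by (auto simp: set_down)
    qed (use w in simp_all)
    finally show "transfer [Suc x, x] g (\<lambda>g. transfer (down (x - 1) b) g w) = 0" .
  qed
  then show ?thesis by (simp only: split transfer_append)
qed

text \<open>The cup at \<open>Suc z\<close> comes from a preceding negative marker. A positive
  marker at \<open>z\<close> would leave it intact until the end of the row, where \<open>w\<close>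
  kills it, so all markers are negative. No loop closes, because \<open>Suc z\<close> is matched
  upwards. The cup at \<open>Suc (z - k)\<close>, which a complete run leaves behind, is
  deliberately not among those killed: it will contain the new right end.\<close>

lemma transfer_minus:
  assumes "slot_matching M f" "f (Suc z) = Suc (Suc z)" "k \<le> z" "Suc (Suc z) \<le> M"
    and "\<And>g x. slot_matching M g \<Longrightarrow> g x = Suc x \<Longrightarrow> Suc (z - k) < x \<Longrightarrow> x \<le> Suc z \<Longrightarrow> w g = 0"
  shows "transfer (down z k) f w = A_pow (- int k) * w (chain z k f)"
  using assms
proof (induction k arbitrary: z f)
  case 0
  then show ?case by (simp add: A_pow_0)
next
  case (Suc k)
  note inv = slot_matching_invol[OF Suc.prems(1)]
  have nl: "f z \<noteq> Suc z" using Suc.prems(2) inv[of z] by auto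
  have "transfer (down (z - 1) k) f w = 0"
  proof (rule transfer_keep[OF Suc.prems(1,2)])
    fix g assume "slot_matching M g" "g (Suc z) = Suc (Suc z)"
    then show "w g = 0" using Suc.prems(3) by (intro Suc.prems(5)[of g "Suc z"]) auto
  qed (use Suc.prems(3,4) in \<open>auto simp: set_down\<close>)
  moreover have "transfer (down (z - 1) k) (turnback z f) w
      = A_pow (- int k) * w (chain (z - 1) k (turnback z f))"
  proof (rule Suc.IH)
    show "slot_matching M (turnback z f)"
      using Suc.prems by (intro slot_matching_turnback) auto
    fix g x assume "slot_matching M g" "g x = Suc x" "Suc (z - 1 - k) < x" "x \<le> Suc (z - 1)"
    then show "w g = 0" using Suc.prems(3) by (intro Suc.prems(5)[of g x]) auto
  qed (use Suc.prems in auto)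
  ultimately show ?case using nl by (simp add: A_pow_mult_left)
qed

text \<open>Sort the states of the row by the number \<open>c\<close> of leading positive markers;
  after the first negative one, \<open>transfer_minus\<close> forces the rest. The exponent is c -
  (k - c). A start without cups excludes loop factors.\<close>

lemma transfer_row:
  assumes "slot_matching M f" "\<And>y. z - k < y \<Longrightarrow> y \<le> z \<Longrightarrow> f y \<noteq> Suc y" "k \<le> z" "Suc z \<le> M"
    and "\<And>g x. slot_matching M g \<Longrightarrow> g x = Suc x \<Longrightarrow> Suc (z - k) < x \<Longrightarrow> x \<le> z \<Longrightarrow> w g = 0"
  shows "transfer (down z k) f w = (\<Sum>c\<le>k. A_pow (2 * int c - int k) * w (chain (z - c) (k - c) f))"
  using assms(2-)
proof (induction k arbitrary: z)
  case 0
  then show ?case by (simp add: A_pow_0)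
next
  case (Suc k)
  have 1: "transfer (down (z - 1) k) f w
      = (\<Sum>c\<le>k. A_pow (2 * int c - int k) * w (chain (z - 1 - c) (k - c) f))"
  proof (rule Suc.IH)
    fix g x assume "slot_matching M g" "g x = Suc x" "Suc (z - 1 - k) < x" "x \<le> z - 1"
    then show "w g = 0" using Suc.prems(2) by (intro Suc.prems(4)[of g x]) auto
  qed (use Suc.prems in auto)
  have 2: "transfer (down (z - 1) k) (turnback z f) w
      = A_pow (- int k) * w (chain (z - 1) k (turnback z f))"
  proof (rule transfer_minus)
    show "slot_matching M (turnback z f)"
      using Suc.prems by (intro slot_matching_turnback assms) auto
    fix g x assume "slot_matching M g" "g x = Suc x" "Suc (z - 1 - k) < x" "x \<le> Suc (z - 1)"
    then show "w g = 0" using Suc.prems(2) by (intro Suc.prems(4)[of g x]) auto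
  qed (use Suc.prems in auto)
  have "f z \<noteq> Suc z" using Suc.prems by auto
  then show ?case
    by (simp add: 1[unfolded One_nat_def] 2[unfolded One_nat_def] sum.atMost_Suc_shift sum_distrib_left A_pow_mult_left algebra_simps
        del: sum.atMost_Suc)
qed

section \<open>Returns, and arcs that survive the rest of a sweep\<close>

fun side_slots :: "nat \<Rightarrow> nat \<Rightarrow> side \<Rightarrow> nat set" where
  "side_slots m n Top = {1..n}"
| "side_slots m n Right = {n + 1..n + m}"
| "side_slots m n Bottom = {n + m + 1..2 * n + m}"
| "side_slots m n Left = {2 * n + m + 1..2 * n + 2 * m}"

definition slot_return :: "nat \<Rightarrow> nat \<Rightarrow> (nat \<Rightarrow> nat) \<Rightarrow> bool" where
  "slot_return m n f \<longleftrightarrow> (\<exists>S. \<exists>x\<in>side_slots m n S. f x \<in> side_slots m n S)"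

text \<open>It is the support of \<open>w\<close> that is free of returns.\<close>

definition return_free :: "nat \<Rightarrow> nat \<Rightarrow> ((nat \<Rightarrow> nat) \<Rightarrow> laurent) \<Rightarrow> bool" where
  "return_free m n w \<longleftrightarrow>
     (\<forall>g. slot_matching (2 * n + 2 * m) g \<longrightarrow> slot_return m n g \<longrightarrow> w g = 0)"

lemma return_free_0:
  "return_free m n w \<Longrightarrow> slot_matching (2 * n + 2 * m) g \<Longrightarrow>
    x \<in> side_slots m n S \<Longrightarrow> g x \<in> side_slots m n S \<Longrightarrow> w g = 0"
  unfolding return_free_def slot_return_def by blast

text \<open>Slots up to \<open>n + r\<close> are top points or finished right ends, and slots above
  \<open>2 * n + m\<close> are left points; the remaining rows avoid both.\<close>

lemma sweep_return:
  assumes f: "slot_matching (2 * n + 2 * m) f" "f x = y"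
    and S: "x \<in> side_slots m n S" "y \<in> side_slots m n S"
    and xy: "x \<le> n + r \<or> 2 * n + m < x" "y \<le> n + r \<or> 2 * n + m < y"
    and rd: "r + d \<le> m" and w: "return_free m n w"
  shows "transfer (sweep n r d) f w = 0"
proof (rule transfer_keep[OF f])
  fix z assume "z \<in> set (sweep n r d)"
  from set_sweep[OF this]
  show "1 \<le> z \<and> Suc z \<le> 2 * n + 2 * m \<and> x \<notin> {z, Suc z} \<and> y \<notin> {z, Suc z}"
    using xy rd by auto
qed (use S w return_free_0 in blast)

text \<open>Each row moves the cup up by one slot, just as it moves the front. Both ends therefore
  stay on vertical strands and arrive at the bottom side as a return.\<close>

lemma sweep_cup:
  assumes "slot_matching (2 * n + 2 * m) f" "f x = Suc x" "n + r < x" "x < 2 * n + r"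
    and "r + d = m" and w: "return_free m n w"
  shows "transfer (sweep n r d) f w = 0"
  using assms(1-5)
proof (induction d arbitrary: r x f)
  case 0
  then show ?case using return_free_0[OF w, of f x Bottom] by simp
next
  case (Suc d)
  have "transfer (down (2 * n + r) n) f (\<lambda>g. transfer (sweep n (Suc r) d) g w) = 0"
  proof (rule cup_row[OF Suc.prems(1,2)])
    fix g assume "slot_matching (2 * n + 2 * m) g" "g (Suc x) = Suc (Suc x)"
    then show "transfer (sweep n (Suc r) d) g w = 0"
      using Suc.prems by (intro Suc.IH[of g "Suc x"]) auto
  qed (use Suc.prems in auto)
  then show ?case by (simp add: transfer_append)
qed

lemma chain_matching:
  assumes "slot_matching M f" "k \<le> z" "Suc z \<le> M"
  shows "slot_matching M (chain z k f)"
  using assms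
proof (induction k arbitrary: z f)
  case (Suc k)
  then show ?case using slot_matching_turnback[of M f z] by simp
qed simp

lemma chain_keep:
  assumes "slot_matching M f" "f x = y" "k \<le> z" "Suc z \<le> M"
    and "x \<le> z - k \<or> Suc z < x" "y \<le> z - k \<or> Suc z < y"
  shows "chain z k f x = y"
  using assms
proof (induction k arbitrary: z f)
  case (Suc k)
  have "turnback z f x = y"
    using Suc.prems by (intro turnback_keep) auto
  moreover have "slot_matching M (turnback z f)"
    using Suc.prems by (intro slot_matching_turnback) auto
  ultimately show ?case using Suc.prems Suc.IH[of "turnback z f" "z - 1"] by auto
qed simp

text \<open>The first turnback of a chain joins the partners of the two slots it acts on.\<close>

lemma sweep_chain_return:
  assumes f: "slot_matching (2 * n + 2 * m) f" "f z = x" "f (Suc z) = y"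
    and S: "x \<in> side_slots m n S" "y \<in> side_slots m n S"
    and xy: "x \<le> n + r \<or> 2 * n + m < x" "y \<le> n + r \<or> 2 * n + m < y"
    and rd: "r + d < m" "n + r < z" "z \<le> 2 * n + r" and w: "return_free m n w"
  shows "transfer (sweep n (Suc r) d) (chain z (z - (n + r)) f) w = 0"
proof -
  define k where "k = z - 1 - (n + r)"
  have k: "z - (n + r) = Suc k" using rd by (simp add: k_def)
  have xz: "x \<noteq> z" "x \<noteq> Suc z" "y \<noteq> z" "y \<noteq> Suc z" using xy rd by auto
  have t: "turnback z f x = y"
    using xz f slot_matching_invol[OF f(1), of z] by (simp add: bypass_def)
  have tm: "slot_matching (2 * n + 2 * m) (turnback z f)"
    using rd by (intro slot_matching_turnback f) auto
  show ?thesis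
  proof (rule sweep_return[OF _ _ S])
    show "chain z (z - (n + r)) f x = y"
      unfolding k chain.simps by (rule chain_keep[OF tm t]) (use xy rd k_def in auto)
    show "slot_matching (2 * n + 2 * m) (chain z (z - (n + r)) f)"
      using rd by (intro chain_matching f) auto
  qed (use xy rd w in auto)
qed

text \<open>The matching reached after \<open>p + q\<close> rows, \<open>p\<close> of them all positive and \<open>q\<close> all negative
  up to forced markers: nested arcs around the four ends of the top and of the current front, and
  parallel strands in between. Every branch reflects an interval of slots.\<close>

definition arcs :: "nat \<Rightarrow> nat \<Rightarrow> nat \<Rightarrow> nat \<Rightarrow> nat \<Rightarrow> nat" where
  "arcs m n p q s =
    (if s < 1 then s
     else if s \<le> q then 2 * n + 2 * m + 1 - s
     else if s \<le> n - p then 2 * n + 1 + 2 * q - s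
     else if s \<le> n + p then 2 * n + 1 - s
     else if s \<le> n + p + 2 * q then 2 * n + 2 * p + 2 * q + 1 - s
     else if s \<le> 2 * n + q then 2 * n + 1 + 2 * q - s
     else if s \<le> 2 * n + 2 * m - q then 4 * n + 2 * m + 1 - s
     else if s \<le> 2 * n + 2 * m then 2 * n + 2 * m + 1 - s
     else s)"

section \<open>The matchings \<open>arcs\<close> and the two surviving runs\<close>

lemma arcs_init:
  assumes "m \<le> n"
  shows "slot_matching (2 * n + 2 * m) (arcs m n 0 0)"
proof -
  \<comment> \<open>Each reflection is written as a constant sum, which leaves the remaining claims
    to linear arithmetic.\<close>
  have e: "s = 0 \<and> t = 0 \<or> 1 \<le> s \<and> s \<le> 2 * n \<and> t + s = 2 * n + 1
      \<or> 2 * n < s \<and> s \<le> 2 * n + 2 * m \<and> t + s = 4 * n + 2 * m + 1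
      \<or> 2 * n + 2 * m < s \<and> t = s" if "t = arcs m n 0 0 s" for s t
  proof -
    have "t = (if s = 0 \<or> 2 * n + 2 * m < s then s else if s \<le> 2 * n then 2 * n + 1 - s
        else 4 * n + 2 * m + 1 - s)"
      using assms by (auto simp: that arcs_def)
    then show ?thesis by (auto split: if_splits)
  qed
  have "arcs m n 0 0 (arcs m n 0 0 x) = x" for x
    using e[OF refl, of "arcs m n 0 0 x"] e[OF refl, of x] by (elim disjE; linarith)
  moreover have "arcs m n 0 0 x \<noteq> x \<longleftrightarrow> x \<in> {1..2 * n + 2 * m}" for x
  proof -
    \<comment> \<open>The two ends of an arc have odd sum, so they are distinct.\<close>
    have "t \<noteq> s" if "t + s = 2 * k + 1" for t s k :: nat
      using that by presburger
    from this[of "arcs m n 0 0 x" x n] this[of "arcs m n 0 0 x" x "2 * n + m"]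
    show ?thesis using e[OF refl, of x] by auto
  qed
  moreover have "\<not> (a < b \<and> b < arcs m n 0 0 a \<and> arcs m n 0 0 a < arcs m n 0 0 b)" for a b
    using e[OF refl, of a] e[OF refl, of b] by (elim disjE; linarith)
  ultimately show ?thesis unfolding slot_matching_def by blast
qed

text \<open>The last \<open>q\<close> markers of this row are negative: the \<open>q\<close> nested
  right arcs must make room for the new right end, since a positive marker throughout would leave it
  matched to another right end. For \<open>q > 0\<close> the run joins top slot \<open>n - p\<close>
  to right slot \<open>n + p + 1\<close>, one more top-right arc; for \<open>q = 0\<close> that arc
  is there already.\<close>

lemma arcs_plus:
  assumes "p + q < m" "m \<le> n" and a: "slot_matching (2 * n + 2 * m) (arcs m n p q)"
  shows "chain (n + p + 2 * q) q (arcs m n p q) = arcs m n (Suc p) q"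
proof (cases q)
  case 0
  then show ?thesis using assms by (auto simp: arcs_def fun_eq_iff)
next
  case (Suc k)
  \<comment> \<open>\<open>c\<close> is the slot of the new right end, where the run leaves its
    cup.\<close>
  define z c where "z = n + p + 2 * q" and "c = n + p + q + 1"
  have q: "1 \<le> q" using Suc by simp
  have 1: "arcs m n p q z = n + p + 1" "arcs m n p q (Suc z) = n - p"
    using assms q unfolding z_def by (auto simp: arcs_def)
  have c: "z - k = c" using Suc by (simp add: z_def c_def)
  have "chain z (Suc k) (arcs m n p q) = arcs m n (Suc p) q"
  proof (subst chain_formula[OF a], goal_cases)
    case 4
    show ?case unfolding c
    proof
      fix y
      let ?R = "\<lambda>u. let v = bypass z (arcs m n p q) (arcs m n p q u) in if c \<le> v \<and> v < z then v + 2 else v"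
      \<comment> \<open>A partner outside the interval from \<open>c\<close> to \<open>Suc z\<close>
        is neither moved nor rerouted.\<close>
      have same: "?R y = arcs m n (Suc p) q y"
        if "arcs m n p q y = v" "arcs m n (Suc p) q y = v" "v < c \<or> Suc z < v" for v
        using that q by (auto simp: bypass_def z_def c_def)
      have main: "arcs m n (Suc p) q y = ?R (if c < y \<and> y \<le> Suc z then y - 2 else y)"
        if y: "y \<noteq> c" "y \<noteq> Suc c"
      proof -
        consider "Suc (Suc c) \<le> y" "y \<le> Suc z" | "y \<le> c" | "Suc z < y" using y by linarith
        then show ?thesis
        proof cases
          case 1
          then have v: "arcs m n p q (y - 2) = 2 * n + 2 * p + 2 * q + 3 - y"
            "arcs m n (Suc p) q y = 2 * n + 2 * p + 2 * q + 3 - y"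
            using assms q by (auto simp: arcs_def z_def c_def)
          moreover have "2 * n + 2 * p + 2 * q + 3 - y < c" using 1 by (simp add: c_def)
          ultimately show ?thesis using 1 by (auto simp: Let_def bypass_def z_def c_def)
        next
          case 2
          then consider "y = 0" | "1 \<le> y" "y \<le> q" | "q < y" "y < n - p" | "y = n - p" | "n - p < y" "y \<le> n + p"
            | "y = n + p + 1" | "n + p + 1 < y" "y \<le> n + p + q" using y unfolding c_def by linarith
          then have "?R y = arcs m n (Suc p) q y"
          proof cases
            case 1
            then show ?thesis by (intro same[of 0]) (auto simp: arcs_def c_def)
          next
            case 2
            then show ?thesis using assms by (intro same[of "2 * n + 2 * m + 1 - y"]) (auto simp: arcs_def c_def z_def)
          next
            case 3
            then show ?thesis using assms by (intro same[of "2 * n + 1 + 2 * q - y"]) (auto simp: arcs_def c_def z_def)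
          next
            case 4
            then have "arcs m n p q y = Suc z" "arcs m n (Suc p) q y = n + p + 1"
              using assms by (auto simp: arcs_def z_def)
            then show ?thesis using 1 q by (auto simp: bypass_def c_def)
          next
            case 5
            then show ?thesis using assms by (intro same[of "2 * n + 1 - y"]) (auto simp: arcs_def c_def z_def)
          next
            case 6
            then have "arcs m n p q y = z" "arcs m n (Suc p) q y = n - p"
              using assms q by (auto simp: arcs_def z_def)
            then show ?thesis using 1 by (auto simp: Let_def bypass_def c_def)
          next
            case 7
            then have "arcs m n p q y = 2 * n + 2 * p + 2 * q + 1 - y"
              "arcs m n (Suc p) q y = 2 * n + 2 * p + 2 * q + 3 - y"
              using assms q by (auto simp: arcs_def z_def)
            then show ?thesis using 7 by (auto simp: Let_def bypass_def c_def z_def)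
          qed
          then show ?thesis using 2 by simp
        next
          case 3
          then consider "y \<le> 2 * n + q" | "2 * n + q < y" "y \<le> 2 * n + 2 * m - q"
            | "2 * n + 2 * m - q < y" "y \<le> 2 * n + 2 * m" | "2 * n + 2 * m < y" by linarith
          then have "?R y = arcs m n (Suc p) q y"
          proof cases
            case 1
            then show ?thesis using 3 assms by (intro same[of "2 * n + 1 + 2 * q - y"]) (auto simp: arcs_def c_def z_def)
          next
            case 2
            then show ?thesis using 3 assms by (intro same[of "4 * n + 2 * m + 1 - y"]) (auto simp: arcs_def c_def z_def)
          next
            case 3
            then show ?thesis using assms by (intro same[of "2 * n + 2 * m + 1 - y"]) (auto simp: arcs_def c_def z_def)
          next
            case 4
            then show ?thesis using 3 assms by (intro same[of y]) (auto simp: arcs_def c_def z_def)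
          qed
          then show ?thesis using 3 by simp
        qed
      qed
      have "arcs m n (Suc p) q c = Suc c" "arcs m n (Suc p) q (Suc c) = c"
        using assms q by (auto simp: arcs_def c_def)
      with main show "(if y = c then Suc y else if y = Suc c then c
        else let u = (if c < y \<and> y \<le> Suc z then y - 2 else y) in ?R u) = arcs m n (Suc p) q y"
        by (simp add: Let_def)
    qed
  qed (use assms 1 q Suc in \<open>auto simp: z_def\<close>)
  then show ?thesis using Suc z_def by simp
qed

text \<open>The \<open>p\<close> leading positive markers pass the front ends that lead to the left
  side, so the run starts at the first end leading to the top. It joins top slot
  \<open>q + 1\<close> to left slot \<open>2 * n + 2 * m - q\<close>, one more top-left arc, and its
  cup is the new innermost right arc.\<close>

lemma arcs_minus:
  assumes "p + q < m" "m \<le> n" and a: "slot_matching (2 * n + 2 * m) (arcs m n p q)"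
  shows "chain (2 * n + q) (n - p) (arcs m n p q) = arcs m n p (Suc q)"
proof -
  define z c k where "z = 2 * n + q" and "c = n + p + q + 1" and "k = n - p - 1"
  have k: "n - p = Suc k" using assms by (simp add: k_def)
  have 1: "arcs m n p q z = q + 1" "arcs m n p q (Suc z) = 2 * n + 2 * m - q"
    using assms unfolding z_def by (auto simp: arcs_def)
  have c: "z - k = c" using assms by (simp add: z_def c_def k_def)
  have "chain z (Suc k) (arcs m n p q) = arcs m n p (Suc q)"
  proof (subst chain_formula[OF a], goal_cases)
    case 4
    show ?case unfolding c
    proof
      fix y
      let ?R = "\<lambda>u. let v = bypass z (arcs m n p q) (arcs m n p q u) in if c \<le> v \<and> v < z then v + 2 else v"
      have same: "?R y = arcs m n p (Suc q) y"
        if "arcs m n p q y = v" "arcs m n p (Suc q) y = v" "v < c \<or> Suc z < v" for v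
        using that assms by (auto simp: bypass_def z_def c_def)
      have main: "arcs m n p (Suc q) y = ?R (if c < y \<and> y \<le> Suc z then y - 2 else y)"
        if y: "y \<noteq> c" "y \<noteq> Suc c"
      proof -
        consider "Suc (Suc c) \<le> y" "y \<le> n + p + 2 * q + 2" | "Suc (Suc c) \<le> y" "n + p + 2 * q + 2 < y" "y \<le> Suc z"
          | "y \<le> c" | "Suc z < y" using y by linarith
        then show ?thesis
        proof cases
          case 1
          then have v: "arcs m n p q (y - 2) = 2 * n + 2 * p + 2 * q + 3 - y"
            "arcs m n p (Suc q) y = 2 * n + 2 * p + 2 * q + 3 - y"
            using assms by (auto simp: arcs_def z_def c_def)
          moreover have "2 * n + 2 * p + 2 * q + 3 - y < c" using 1 by (simp add: c_def)
          moreover have "y \<le> Suc z" using 1 assms by (simp add: z_def)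
          ultimately show ?thesis using 1 assms by (auto simp: Let_def bypass_def z_def c_def)
        next
          case 2
          then have v: "arcs m n p q (y - 2) = 2 * n + 3 + 2 * q - y"
            "arcs m n p (Suc q) y = 2 * n + 3 + 2 * q - y"
            using assms by (auto simp: arcs_def z_def c_def)
          moreover have "2 * n + 3 + 2 * q - y < c" using 2 by (simp add: c_def)
          ultimately show ?thesis using 2 assms by (auto simp: Let_def bypass_def z_def c_def)
        next
          case 3
          then consider "y = 0" | "1 \<le> y" "y \<le> q" | "y = q + 1" | "q + 1 < y" "y \<le> n - p" | "n - p < y" "y \<le> n + p"
            | "n + p < y" "y \<le> n + p + q" using y unfolding c_def by linarith
          then have "?R y = arcs m n p (Suc q) y"
          proof cases
            case 1
            then show ?thesis by (intro same[of 0]) (auto simp: arcs_def c_def)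
          next
            case 2
            then show ?thesis using assms by (intro same[of "2 * n + 2 * m + 1 - y"]) (auto simp: arcs_def c_def z_def)
          next
            case 3
            then have "arcs m n p q y = z" "arcs m n p (Suc q) y = 2 * n + 2 * m - q"
              using assms by (auto simp: arcs_def z_def)
            then show ?thesis using 1 assms by (auto simp: Let_def bypass_def c_def z_def)
          next
            case 4
            then have "arcs m n p q y = 2 * n + 1 + 2 * q - y" "arcs m n p (Suc q) y = 2 * n + 3 + 2 * q - y"
              using assms by (auto simp: arcs_def z_def)
            then show ?thesis using 4 assms by (auto simp: Let_def bypass_def c_def z_def)
          next
            case 5
            then show ?thesis using assms by (intro same[of "2 * n + 1 - y"]) (auto simp: arcs_def c_def z_def)
          next
            case 6
            then have "arcs m n p q y = 2 * n + 2 * p + 2 * q + 1 - y"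
              "arcs m n p (Suc q) y = 2 * n + 2 * p + 2 * q + 3 - y"
              using assms by (auto simp: arcs_def z_def)
            then show ?thesis using 6 assms by (auto simp: Let_def bypass_def c_def z_def)
          qed
          then show ?thesis using 3 by simp
        next
          case 4
          then consider "y < 2 * n + 2 * m - q" | "y = 2 * n + 2 * m - q"
            | "2 * n + 2 * m - q < y" "y \<le> 2 * n + 2 * m" | "2 * n + 2 * m < y" by linarith
          then have "?R y = arcs m n p (Suc q) y"
          proof cases
            case 1
            then show ?thesis using 4 assms by (intro same[of "4 * n + 2 * m + 1 - y"]) (auto simp: arcs_def c_def z_def)
          next
            case 2
            then have "arcs m n p q y = Suc z" "arcs m n p (Suc q) y = q + 1"
              using assms by (auto simp: arcs_def z_def)
            then show ?thesis using 1 assms by (auto simp: Let_def bypass_def c_def)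
          next
            case 3
            then show ?thesis using assms by (intro same[of "2 * n + 2 * m + 1 - y"]) (auto simp: arcs_def c_def z_def)
          next
            case 4
            then show ?thesis using assms by (intro same[of y]) (auto simp: arcs_def c_def z_def)
          qed
          then show ?thesis using 4 by simp
        qed
      qed
      have "arcs m n p (Suc q) c = Suc c" "arcs m n p (Suc q) (Suc c) = c"
        using assms by (auto simp: arcs_def c_def)
      with main show "(if y = c then Suc y else if y = Suc c then c
        else let u = (if c < y \<and> y \<le> Suc z then y - 2 else y) in ?R u) = arcs m n p (Suc q) y"
        by (simp add: Let_def)
    qed
  qed (use assms 1 k in \<open>auto simp: z_def\<close>)
  then show ?thesis using k z_def by simp
qed

text \<open>Each of these matchings is reached from \<open>arcs m n 0 0\<close> by runs of
  turnbacks, which preserve matchings. This avoids checking the noncrossing condition on the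
  explicit formula.\<close>

lemma slot_matching_arcs:
  assumes "m \<le> n"
  shows "p + q \<le> m \<Longrightarrow> slot_matching (2 * n + 2 * m) (arcs m n p q)"
proof (induction "p + q" arbitrary: p q)
  case 0
  then show ?case using arcs_init assms by simp
next
  case (Suc r)
  show ?case
  proof (cases p)
    case 0
    then obtain q' where q': "q = Suc q'" using Suc by (cases q) auto
    then have a: "slot_matching (2 * n + 2 * m) (arcs m n p q')" using Suc by auto
    show ?thesis
      unfolding q' by (subst arcs_minus[symmetric, OF _ assms a], use Suc.prems q' in simp)
        (rule chain_matching[OF a], use assms Suc.prems q' in auto)
  next
    case (Suc p')
    then have a: "slot_matching (2 * n + 2 * m) (arcs m n p' q)" using Suc.hyps Suc.prems by auto
    show ?thesis
      unfolding Suc by (subst arcs_plus[symmetric, OF _ assms a], use Suc.prems Suc in simp)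
        (rule chain_matching[OF a], use assms Suc.prems Suc in auto)
  qed
qed

lemma transfer_arcs_row:
  assumes pq: "p + q + Suc d = m" and mn: "m \<le> n" and w: "return_free m n w"
  shows "transfer (sweep n (p + q) (Suc d)) (arcs m n p q) w =
    A_pow (int n - 2 * int q) * transfer (sweep n (Suc (p + q)) d) (arcs m n (Suc p) q) w +
    A_pow (2 * int p - int n) * transfer (sweep n (Suc (p + q)) d) (arcs m n p (Suc q)) w"
proof -
  define r f where "r = p + q" and "f = arcs m n p q"
  define W where "W = (\<lambda>g. transfer (sweep n (Suc r) d) g w)"
  have a: "slot_matching (2 * n + 2 * m) f" unfolding f_def using slot_matching_arcs pq mn by auto
  have lt: "p + q < m" "p + q < n" using pq mn by auto
  have sum: "transfer (down (2 * n + r) n) f W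
      = (\<Sum>c\<le>n. A_pow (2 * int c - int n) * W (chain (2 * n + r - c) (n - c) f))"
  proof (rule transfer_row[OF a])
    \<comment> \<open>Every vertical end of the front leads to the right side, the top or the left
      side, so the row starts without cups.\<close>
    fix y assume y: "2 * n + r - n < y" "y \<le> 2 * n + r"
    consider "y \<le> n + p + 2 * q" | "n + p + 2 * q < y" "y \<le> 2 * n + q" | "2 * n + q < y" by linarith
    then show "f y \<noteq> Suc y"
    proof cases
      case 1
      then have "f y = 2 * n + 2 * p + 2 * q + 1 - y" using y lt mn unfolding f_def r_def by (simp add: arcs_def)
      then show ?thesis using y unfolding r_def by simp
    next
      case 2
      then have "f y = 2 * n + 1 + 2 * q - y" using y lt mn unfolding f_def r_def by (simp add: arcs_def)
      then show ?thesis using y 2 unfolding r_def by simp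
    next
      case 3
      then have "f y = 4 * n + 2 * m + 1 - y" using y lt mn unfolding f_def r_def by (simp add: arcs_def)
      then show ?thesis using y 3 lt unfolding r_def by simp
    qed
  next
    fix g x assume "slot_matching (2 * n + 2 * m) g" "g x = Suc x" "Suc (2 * n + r - n) < x" "x \<le> 2 * n + r"
    then show "W g = 0"
      unfolding W_def using pq w by (intro sweep_cup[of n m g x]) (auto simp: r_def)
  qed (use pq mn in \<open>auto simp: r_def\<close>)
  \<comment> \<open>The first negative marker acts at \<open>z\<close> and \<open>Suc z\<close>.
    Both lead to the left side if \<open>c < p\<close>, to the top if \<open>p < c < n - q\<close>,
    and to the right side if \<open>n - q < c < n\<close>. If \<open>c = n\<close> and
    \<open>q > 0\<close>, no turnback occurs and the new right end stays matched to the right end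
    above it.\<close>
  have 0: "W (chain (2 * n + r - c) (n - c) f) = 0" if c: "c \<le> n" "c \<noteq> p" "c \<noteq> n - q" for c
  proof -
    define z where "z = 2 * n + r - c"
    have len: "n - c = z - (n + r)" using c by (simp add: z_def)
    consider "c < p" | "p < c" "c < n - q" | "n - q < c" "c < n" | "c = n" "q \<noteq> 0" using c by linarith
    then show ?thesis
    proof cases
      case 1
      then have "f z = 4 * n + 2 * m + 1 - z" "f (Suc z) = 4 * n + 2 * m - z"
        using lt mn unfolding f_def z_def r_def by (auto simp: arcs_def)
      then show ?thesis unfolding W_def len z_def[symmetric]
        by (rule sweep_chain_return[OF a, where S = Left])
          (use 1 w lt pq in \<open>auto simp: z_def r_def\<close>)
    next
      case 2
      then have "f z = 2 * n + 1 + 2 * q - z" "f (Suc z) = 2 * n + 2 * q - z"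
        using lt mn unfolding f_def z_def r_def by (auto simp: arcs_def)
      then show ?thesis unfolding W_def len z_def[symmetric]
        by (rule sweep_chain_return[OF a, where S = Top])
          (use 2 w lt pq in \<open>auto simp: z_def r_def\<close>)
    next
      case 3
      then have "f z = 2 * n + 2 * p + 2 * q + 1 - z" "f (Suc z) = 2 * n + 2 * p + 2 * q - z"
        using lt mn unfolding f_def z_def r_def by (auto simp: arcs_def)
      then show ?thesis unfolding W_def len z_def[symmetric]
        by (rule sweep_chain_return[OF a, where S = Right])
          (use 3 w lt pq in \<open>auto simp: z_def r_def\<close>)
    next
      case 4
      have "f (n + r + 1) = n + r"
        using lt mn 4 unfolding f_def z_def r_def by (simp add: arcs_def)
      then show ?thesis unfolding W_def len z_def[symmetric]
        by (subst len[symmetric]) (use 4 w lt pq in \<open>auto simp: r_def intro!: sweep_return[OF a, of "n + r + 1" "n + r" Right]\<close>)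
    qed
  qed
  \<comment> \<open>The two surviving values of \<open>c\<close> are distinct because
    \<open>p + q < n\<close>.\<close>
  have "n - q \<le> n" "p \<le> n" "p \<noteq> n - q" using lt by auto
  then have "transfer (down (2 * n + r) n) f W
      = (\<Sum>c\<in>{n - q, p}. A_pow (2 * int c - int n) * W (chain (2 * n + r - c) (n - c) f))"
    unfolding sum by (intro sum.mono_neutral_right) (use 0 in auto)
  also have "\<dots> = A_pow (2 * int (n - q) - int n) * W (chain (2 * n + r - (n - q)) (n - (n - q)) f)
     + A_pow (2 * int p - int n) * W (chain (2 * n + r - p) (n - p) f)"
    using \<open>p \<noteq> n - q\<close> by simp
  also have "2 * n + r - (n - q) = n + p + 2 * q" using lt by (simp add: r_def)
  also have "n - (n - q) = q" using lt by simp
  also have "2 * n + r - p = 2 * n + q" by (simp add: r_def)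
  also have "chain (n + p + 2 * q) q f = arcs m n (Suc p) q"
    using arcs_plus[OF lt(1) mn] a by (simp add: f_def)
  also have "chain (2 * n + q) (n - p) f = arcs m n p (Suc q)"
    using arcs_minus[OF lt(1) mn] a by (simp add: f_def)
  also have "2 * int (n - q) - int n = int n - 2 * int q" using lt by simp
  finally show ?thesis
    unfolding sweep.simps transfer_append r_def[symmetric] f_def[symmetric] W_def .
qed

section \<open>Gaussian weights\<close>

lemma q_int_Suc_nonzero: "q_int (Suc k) \<noteq> 0"
proof
  assume "q_int (Suc k) = 0"
  then have "poly (q_int (Suc k)) 1 = 0" by simp
  moreover have "poly (q_int (Suc k)) 1 = int (Suc k)" by (simp add: q_int_def poly_sum poly_monom)
  ultimately show False by simp
qed

lemma q_fact_nonzero: "q_fact k \<noteq> 0"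
  by (induction k) (simp_all add: q_fact_def q_int_Suc_nonzero)

lemma q_binomial_mult: "q_binomial (p + q) q * (q_fact q * q_fact p) = q_fact (p + q)"
  using q_binomial_exact[of q "p + q"] by simp

lemma q_binomial_0 [simp]: "q_binomial p 0 = 1" and q_binomial_self [simp]: "q_binomial q q = 1"
  using q_fact_nonzero by (simp_all add: q_binomial_def q_fact_def[of 0])

text \<open>The Pascal rule with the power of q on the summand whose last row is positive.
  Multiplying by both factorials removes the divisions and reduces it to
  \<open>q_int_add\<close>.\<close>

lemma q_binomial_Suc_Suc:
  "q_binomial (Suc p + Suc q) (Suc q) =
     monom 1 (Suc q) * q_binomial (p + Suc q) (Suc q) + q_binomial (Suc p + q) q" (is "?l = ?r")
proof -
  have "?r * (q_fact (Suc q) * q_fact (Suc p))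
      = monom 1 (Suc q) * q_int (Suc p) * (q_binomial (p + Suc q) (Suc q) * (q_fact (Suc q) * q_fact p))
        + q_int (Suc q) * (q_binomial (Suc p + q) q * (q_fact q * q_fact (Suc p)))"
    by (simp only: q_fact_Suc[of p] q_fact_Suc[of q] algebra_simps)
  also have "\<dots> = (q_int (Suc q) + monom 1 (Suc q) * q_int (Suc p)) * q_fact (Suc (p + q))"
    unfolding q_binomial_mult by (simp add: algebra_simps)
  also have "\<dots> = q_int (Suc q + Suc p) * q_fact (Suc (p + q))"
    by (simp only: q_int_add)
  also have "\<dots> = q_fact (Suc p + Suc q)"
    using q_fact_Suc[of "Suc (p + q)"] by (simp add: add.commute)
  also have "\<dots> = ?l * (q_fact (Suc q) * q_fact (Suc p))"
    by (rule q_binomial_mult[symmetric])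
  finally show ?thesis using q_fact_nonzero by simp
qed

lemma eval_laurent_add: "eval_laurent (p + q) x = eval_laurent p x + eval_laurent q x"
proof -
  have "map_poly of_int (p + q) = (map_poly of_int p + map_poly of_int q :: laurent poly)"
    by (rule poly_eqI) (simp add: coeff_map_poly)
  then show ?thesis by (simp add: eval_laurent_def)
qed

lemma eval_laurent_monom_mult: "eval_laurent (monom 1 k * p) x = x ^ k * eval_laurent p x"
proof -
  have "map_poly of_int (monom 1 k * p) = (monom 1 k * map_poly of_int p :: laurent poly)"
    by (rule poly_eqI) (simp add: coeff_map_poly coeff_monom_mult)
  then show ?thesis by (simp add: eval_laurent_def poly_monom)
qed

lemma eval_laurent_1 [simp]: "eval_laurent 1 x = 1"
  by (simp add: eval_laurent_def)

lemma A_pow_power: "A_pow e ^ k = A_pow (int k * e)"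
  by (induction k) (simp_all add: A_pow_0 algebra_simps)

text \<open>The exponent n p + q (2 p - n) belongs to the path with all \<open>p\<close> positive
  rows first; the Gaussian binomial compares the other paths with it.\<close>

definition weight :: "nat \<Rightarrow> nat \<Rightarrow> nat \<Rightarrow> laurent" where
  "weight n p q = A_pow (int n * int p - int n * int q + 2 * int p * int q) *
     eval_laurent (q_binomial (p + q) q) (A_pow (- 4))"

lemma weight_Suc_0: "weight n (Suc p) 0 = A_pow (int n) * weight n p 0"
  by (simp add: weight_def algebra_simps)

lemma weight_0_Suc: "weight n 0 (Suc q) = A_pow (- int n) * weight n 0 q"
  by (simp add: weight_def algebra_simps)

text \<open>The summands are the paths ending in a positive and in a negative row. The factor A^(-4
  (q + 1)) that the Pascal rule requires on the first arises half from the row weight A^(n - 2 (q +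
  1)) and half from the change of the term 2 p q in the exponent.\<close>

lemma weight_Suc_Suc: "weight n (Suc p) (Suc q) =
    A_pow (int n - 2 * int (Suc q)) * weight n p (Suc q) + A_pow (2 * int (Suc p) - int n) * weight n (Suc p) q"
  unfolding weight_def q_binomial_Suc_Suc eval_laurent_add eval_laurent_monom_mult A_pow_power
    distrib_left A_pow_mult_left
  by (simp add: A_pow_mult_left mult.assoc[symmetric]) (simp add: algebra_simps)

text \<open>Negative rows create the left-top arcs, so the first index counts negative rows.\<close>

lemma P_coeff_eq: "P_coeff q p h = weight (p + q + h) p q"
  by (simp add: P_coeff_def weight_def Let_def algebra_simps)

lemma transfer_arcs_rows:
  assumes mn: "m \<le> n" and w: "return_free m n w"
  shows "r \<le> m \<Longrightarrow> transfer (sweep n 0 m) (arcs m n 0 0) w =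
    (\<Sum>q\<le>r. weight n (r - q) q * transfer (sweep n r (m - r)) (arcs m n (r - q) q) w)"
proof (induction r)
  case 0
  then show ?case by (simp add: weight_def A_pow_0)
next
  case (Suc r)
  define X where "X p q = transfer (sweep n (Suc r) (m - Suc r)) (arcs m n p q) w" for p q
  \<comment> \<open>\<open>a q\<close> and \<open>b q\<close> collect the paths whose last row is
    positive and negative. The default value 0 lets both sums run over the same range.\<close>
  define a where "a q = (if q \<le> r then A_pow (int n - 2 * int q) * weight n (r - q) q else 0)" for q
  define b where "b q = (case q of 0 \<Rightarrow> 0 | Suc q' \<Rightarrow> A_pow (2 * int (r - q') - int n) * weight n (r - q') q')" for q
  have row: "transfer (sweep n r (m - r)) (arcs m n (r - q) q) w =
     A_pow (int n - 2 * int q) * X (Suc r - q) q + A_pow (2 * int (r - q) - int n) * X (r - q) (Suc q)"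
    if "q \<le> r" for q
    using transfer_arcs_row[OF _ mn w, of "r - q" q "m - Suc r"] that Suc.prems
    by (simp add: X_def Suc_diff_Suc Suc_diff_le)
  have ab: "weight n (Suc r - q) q = a q + b q" if q: "q \<le> Suc r" for q
  proof (cases q)
    case 0
    then show ?thesis by (simp add: a_def b_def weight_Suc_0)
  next
    case (Suc q')
    show ?thesis
    proof (cases "q' = r")
      case True
      then show ?thesis using Suc by (simp add: a_def b_def weight_0_Suc)
    next
      case False
      then obtain p where "r - q' = Suc p" "Suc r - q = Suc p" "r - q = p" using q Suc
        by (metis Suc_diff_Suc Suc_le_mono diff_Suc_Suc le_neq_implies_less)
      then show ?thesis using q Suc False weight_Suc_Suc[of n p q'] by (simp add: a_def b_def)
    qed
  qed
  have "transfer (sweep n 0 m) (arcs m n 0 0) w =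
      (\<Sum>q\<le>r. weight n (r - q) q * (A_pow (int n - 2 * int q) * X (Suc r - q) q
        + A_pow (2 * int (r - q) - int n) * X (r - q) (Suc q)))"
    using Suc row by simp
  also have "\<dots> = (\<Sum>q\<le>r. a q * X (Suc r - q) q) + (\<Sum>q\<le>r. b (Suc q) * X (Suc r - Suc q) (Suc q))"
    unfolding sum.distrib[symmetric] by (rule sum.cong) (simp_all add: a_def b_def algebra_simps)
  also have "(\<Sum>q\<le>r. a q * X (Suc r - q) q) = (\<Sum>q\<le>Suc r. a q * X (Suc r - q) q)"
    by (simp add: a_def)
  also have "(\<Sum>q\<le>r. b (Suc q) * X (Suc r - Suc q) (Suc q)) = (\<Sum>q\<le>Suc r. b q * X (Suc r - q) q)"
    by (subst sum.atMost_Suc_shift) (simp add: b_def)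
  also have "(\<Sum>q\<le>Suc r. a q * X (Suc r - q) q) + (\<Sum>q\<le>Suc r. b q * X (Suc r - q) q)
      = (\<Sum>q\<le>Suc r. weight n (Suc r - q) q * X (Suc r - q) q)"
    unfolding sum.distrib[symmetric] by (rule sum.cong) (simp_all add: ab distrib_right)
  finally show ?case by (simp only: X_def)
qed

lemma transfer_lattice:
  assumes "int h = int n - int m" and w: "return_free m n w"
  shows "transfer (sweep n 0 m) (arcs m n 0 0) w =
    (\<Sum>k=0..m. P_coeff k (m - k) h * w (arcs m n (m - k) k))"
proof -
  have n: "m \<le> n" "n = m + h" using assms by simp_all
  show ?thesis
    unfolding transfer_arcs_rows[OF n(1) w order_refl] atMost_atLeast0
    by (rule sum.cong) (auto simp: P_coeff_eq n(2))
qed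

section \<open>Kauffman states as sweeps\<close>

definition crossing_slot :: "nat \<Rightarrow> nat \<times> nat \<Rightarrow> nat" where
  "crossing_slot n c = 2 * n + fst c - snd c"

definition resolve :: "nat \<Rightarrow> kstate \<Rightarrow> nat \<times> nat \<Rightarrow> (nat \<Rightarrow> nat) \<times> nat \<Rightarrow> (nat \<Rightarrow> nat) \<times> nat" where
  "resolve n s c x = (let f = fst x; l = snd x; z = crossing_slot n c in
     if s c = Positive then x else (turnback z f, if f z = Suc z then Suc l else l))"

definition marker_sign :: "marker \<Rightarrow> int" where
  "marker_sign \<mu> = (if \<mu> = Positive then 1 else - 1)"

lemma UNIV_marker: "UNIV = {Positive, Negative}"
  using marker.exhaust by blast

lemma fold_resolve_cong:
  "(\<And>c. c \<in> set cs \<Longrightarrow> s c = s' c) \<Longrightarrow> fold (resolve n s) cs x = fold (resolve n s') cs x"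
  by (rule fold_cong) (auto simp: resolve_def fun_eq_iff)

text \<open>The factor \<open>loop_value ^ l\<close> lets the induction continue from any number of
  loops already closed.\<close>

lemma transfer_state_sum:
  assumes "distinct cs"
  shows "loop_value ^ l * transfer (map (crossing_slot n) cs) f w =
    (\<Sum>s\<in>set cs \<rightarrow>\<^sub>E UNIV. A_pow (\<Sum>c\<in>set cs. marker_sign (s c)) *
       loop_value ^ snd (fold (resolve n s) cs (f, l)) * w (fst (fold (resolve n s) cs (f, l))))"
  using assms
proof (induction cs arbitrary: f l)
  case Nil
  then show ?case by (simp add: A_pow_0)
next
  case (Cons c cs)
  let ?T = "\<lambda>cs s x. A_pow (\<Sum>c\<in>set cs. marker_sign (s c)) *
       loop_value ^ snd (fold (resolve n s) cs x) * w (fst (fold (resolve n s) cs x))"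
  let ?z = "crossing_slot n c"
  let ?E = "set cs \<rightarrow>\<^sub>E (UNIV :: marker set)"
  have c: "c \<notin> set cs" using Cons.prems by simp
  have upd: "?T (c # cs) (s(c := \<mu>)) (f, l)
      = A_pow (marker_sign \<mu>) * ?T cs s (resolve n (\<lambda>_. \<mu>) c (f, l))" for s \<mu>
  proof -
    have "(\<Sum>d\<in>set cs. marker_sign ((s(c := \<mu>)) d)) = (\<Sum>d\<in>set cs. marker_sign (s d))"
      by (rule sum.cong) (use c in auto)
    moreover have "fold (resolve n (s(c := \<mu>))) cs x = fold (resolve n s) cs x" for x
      by (rule fold_resolve_cong) (use c in auto)
    moreover have "resolve n (s(c := \<mu>)) c (f, l) = resolve n (\<lambda>_. \<mu>) c (f, l)"
      by (simp add: resolve_def)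
    ultimately show ?thesis using c by (simp add: A_pow_mult_left mult.assoc)
  qed
  \<comment> \<open>A state on \<open>c # cs\<close> is a marker at \<open>c\<close> together with a
    state on \<open>cs\<close>.\<close>
  have "(\<Sum>s\<in>set (c # cs) \<rightarrow>\<^sub>E UNIV. ?T (c # cs) s (f, l))
      = (\<Sum>(\<mu>, s)\<in>UNIV \<times> ?E. ?T (c # cs) (s(c := \<mu>)) (f, l))"
    unfolding list.set PiE_insert_eq
    by (subst sum.reindex) (use inj_combinator[OF c, of "\<lambda>_. UNIV"] in \<open>auto simp: case_prod_beta\<close>)
  also have "\<dots> = (\<Sum>\<mu>\<in>UNIV. \<Sum>s\<in>?E. A_pow (marker_sign \<mu>) * ?T cs s (resolve n (\<lambda>_. \<mu>) c (f, l)))"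
    unfolding upd by (rule sum.cartesian_product[symmetric])
  also have "\<dots> = (\<Sum>\<mu>\<in>UNIV. A_pow (marker_sign \<mu>) *
      (\<Sum>s\<in>?E. ?T cs s (fst (resolve n (\<lambda>_. \<mu>) c (f, l)), snd (resolve n (\<lambda>_. \<mu>) c (f, l)))))"
    by (simp add: sum_distrib_left)
  also have "\<dots> = (\<Sum>\<mu>\<in>UNIV. A_pow (marker_sign \<mu>) * (loop_value ^ snd (resolve n (\<lambda>_. \<mu>) c (f, l)) *
      transfer (map (crossing_slot n) cs) (fst (resolve n (\<lambda>_. \<mu>) c (f, l))) w))"
    using Cons by simp
  also have "\<dots> = loop_value ^ l * transfer (map (crossing_slot n) (c # cs)) f w"
    by (simp add: UNIV_marker resolve_def Let_def marker_sign_def algebra_simps)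
  finally show ?case by simp
qed

section \<open>The crossings in the order of the sweep\<close>

definition row_crossings :: "nat \<Rightarrow> nat \<Rightarrow> (nat \<times> nat) list" where
  "row_crossings k i = map (Pair i) [1..<Suc k]"

definition lattice_crossings :: "nat \<Rightarrow> nat \<Rightarrow> (nat \<times> nat) list" where
  "lattice_crossings m n = concat (map (row_crossings n) [1..<Suc m])"

lemma set_row_crossings: "set (row_crossings k i) = {i} \<times> {1..k}"
  by (auto simp: row_crossings_def)

lemma set_lattice_crossings: "set (lattice_crossings m n) = crossings m n"
  by (auto simp: lattice_crossings_def set_row_crossings crossings_def)

lemma lattice_crossings_Suc: "lattice_crossings (Suc m) n = lattice_crossings m n @ row_crossings n (Suc m)"
  by (simp add: lattice_crossings_def)

lemma distinct_lattice_crossings: "distinct (lattice_crossings m n)"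
proof (induction m)
  case (Suc m)
  then show ?case
    unfolding lattice_crossings_Suc distinct_append set_lattice_crossings set_row_crossings
    by (auto simp: row_crossings_def distinct_map inj_on_def crossings_def)
qed (simp add: lattice_crossings_def)

lemma down_conv_map: "down z k = map (\<lambda>j. z - j) [0..<k]"
proof (induction k arbitrary: z)
  case (Suc k)
  have "map (\<lambda>j. z - j) [0..<Suc k] = z # map (\<lambda>j. z - Suc j) [0..<k]"
    by (simp add: upt_conv_Cons map_Suc_upt[symmetric] del: upt_Suc)
  then show ?case by (simp add: Suc)
qed simp

lemma map_slot_row: "map (crossing_slot n) (row_crossings k (Suc r)) = down (2 * n + r) k"
  by (simp add: row_crossings_def crossing_slot_def down_conv_map map_Suc_upt[symmetric] del: upt_Suc)

lemma sweep_snoc: "sweep n r (Suc d) = sweep n r d @ down (2 * n + r + d) n"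
proof (induction d arbitrary: r)
  case (Suc d)
  show ?case by (subst sweep.simps(2), subst Suc) simp
qed simp

lemma map_slot_lattice: "map (crossing_slot n) (lattice_crossings m n) = sweep n 0 m"
proof (induction m)
  case 0
  then show ?case by (simp add: lattice_crossings_def)
next
  case (Suc m)
  then show ?case unfolding sweep_snoc lattice_crossings_Suc by (simp add: map_slot_row)
qed

section \<open>Connected components of partial smoothings\<close>

definition linked :: "('a \<times> 'a) set \<Rightarrow> ('a \<times> 'a) set" where
  "linked R = (R \<union> R\<inverse>)\<^sup>*"

lemma linked_refl [simp]: "(x, x) \<in> linked R"
  and linked_base: "(x, y) \<in> R \<Longrightarrow> (x, y) \<in> linked R"
  and linked_trans: "(x, y) \<in> linked R \<Longrightarrow> (y, z) \<in> linked R \<Longrightarrow> (x, z) \<in> linked R"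
  by (auto simp: linked_def)

lemma linked_sym: "(x, y) \<in> linked R \<Longrightarrow> (y, x) \<in> linked R"
  unfolding linked_def by (rule symD[OF sym_rtrancl]) (auto simp: sym_def)

lemma linked_mono: "R \<subseteq> R' \<Longrightarrow> (x, y) \<in> linked R \<Longrightarrow> (x, y) \<in> linked R'"
  unfolding linked_def by (rule subsetD[OF rtrancl_mono]) auto

lemma linked_label:
  assumes "\<And>x y. (x, y) \<in> R \<Longrightarrow> lab x = lab y" and "(x, y) \<in> linked R"
  shows "lab x = lab y"
  using assms(2) unfolding linked_def by (induction rule: rtrancl_induct) (auto dest: assms(1))

text \<open>After smoothing some crossings, \<open>\<sigma> a\<close> is the segment at slot \<open>a\<close>, \<open>R\<close> are the joined
  pairs among the segments \<open>S\<close> reached so far, \<open>f\<close> matches the slots and \<open>l\<close> counts the closed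
  components. The labelling \<open>lab\<close> separates exactly the connected components.\<close>

definition tracks :: "nat \<Rightarrow> (nat \<Rightarrow> 'a) \<Rightarrow> ('a \<times> 'a) set \<Rightarrow> 'a set \<Rightarrow> (nat \<Rightarrow> nat) \<Rightarrow> nat \<Rightarrow> bool" where
  "tracks M \<sigma> R S f l \<longleftrightarrow> slot_matching M f \<and> finite S \<and> \<sigma> ` {1..M} \<subseteq> S \<and> R \<subseteq> S \<times> S \<and>
     (\<exists>lab :: 'a \<Rightarrow> nat. (\<forall>x y. (x, y) \<in> R \<longrightarrow> lab x = lab y) \<and>
       (\<forall>x\<in>S. \<forall>y\<in>S. lab x = lab y \<longrightarrow> (x, y) \<in> linked R) \<and>
       (\<forall>a\<in>{1..M}. \<forall>b\<in>{1..M}. lab (\<sigma> a) = lab (\<sigma> b) \<longleftrightarrow> b = a \<or> b = f a) \<and>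
       card (lab ` S - lab ` \<sigma> ` {1..M}) = l)"

text \<open>A positive marker prolongs the strands at the two slots, so each new segment inherits
  the label of the old one it is joined to.\<close>

lemma tracks_identity:
  assumes t: "tracks M \<sigma> R S f l" and z: "1 \<le> z" "Suc z \<le> M" and new: "h \<notin> S" "v \<notin> S" "h \<noteq> v"
  shows "tracks M (\<sigma>(z := h, Suc z := v)) (R \<union> {(\<sigma> z, h), (\<sigma> (Suc z), v)}) (S \<union> {h, v}) f l"
proof -
  obtain lab :: "'a \<Rightarrow> nat" where f: "slot_matching M f" and S: "finite S" "\<sigma> ` {1..M} \<subseteq> S" "R \<subseteq> S \<times> S"
    and lab: "\<And>x y. (x, y) \<in> R \<Longrightarrow> lab x = lab y"
      "\<And>x y. x \<in> S \<Longrightarrow> y \<in> S \<Longrightarrow> lab x = lab y \<Longrightarrow> (x, y) \<in> linked R"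
      "\<And>a b. a \<in> {1..M} \<Longrightarrow> b \<in> {1..M} \<Longrightarrow> lab (\<sigma> a) = lab (\<sigma> b) \<longleftrightarrow> b = a \<or> b = f a"
      "card (lab ` S - lab ` \<sigma> ` {1..M}) = l"
    using t unfolding tracks_def by blast
  let ?\<sigma> = "\<sigma>(z := h, Suc z := v)" and ?R = "R \<union> {(\<sigma> z, h), (\<sigma> (Suc z), v)}"
  define lab' where "lab' = lab(h := lab (\<sigma> z), v := lab (\<sigma> (Suc z)))"
  \<comment> \<open>\<open>\<rho>\<close> leads a new segment back to the old one it continues, so
    that linking is decided within \<open>R\<close>.\<close>
  define \<rho> where "\<rho> x = (if x = h then \<sigma> z else if x = v then \<sigma> (Suc z) else x)" for x
  have \<sigma>S: "a \<in> {1..M} \<Longrightarrow> \<sigma> a \<in> S" for a using S by auto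
  have zS: "\<sigma> z \<in> S" "\<sigma> (Suc z) \<in> S" using \<sigma>S z by auto
  have old: "x \<in> S \<Longrightarrow> lab' x = lab x" for x using new by (auto simp: lab'_def)
  have hv: "lab' h = lab (\<sigma> z)" "lab' v = lab (\<sigma> (Suc z))" using new by (auto simp: lab'_def)
  have \<rho>: "\<rho> x \<in> S" "lab' x = lab (\<rho> x)" "(x, \<rho> x) \<in> linked ?R" if "x \<in> S \<union> {h, v}" for x
    using that new zS old hv by (auto simp: \<rho>_def intro: linked_base linked_sym)
  have slots: "lab' (?\<sigma> a) = lab (\<sigma> a)" if "a \<in> {1..M}" for a
    using that old hv \<sigma>S by simp
  have L1: "\<forall>x y. (x, y) \<in> ?R \<longrightarrow> lab' x = lab' y"
    using lab(1) S(3) old hv zS by auto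
  have L2: "(x, y) \<in> linked ?R" if "x \<in> S \<union> {h, v}" "y \<in> S \<union> {h, v}" "lab' x = lab' y" for x y
  proof -
    have "(\<rho> x, \<rho> y) \<in> linked R" using that \<rho> by (intro lab(2)) auto
    then have "(\<rho> x, \<rho> y) \<in> linked ?R" by (rule linked_mono[rotated]) auto
    then show ?thesis using \<rho>(3) that linked_trans linked_sym by meson
  qed
  have L3: "\<forall>a\<in>{1..M}. \<forall>b\<in>{1..M}. lab' (?\<sigma> a) = lab' (?\<sigma> b) \<longleftrightarrow> b = a \<or> b = f a"
    using slots lab(3) by simp
  have "lab' ` (S \<union> {h, v}) = lab ` S"
    using old hv zS by (auto simp: image_Un)
  moreover have "lab' ` ?\<sigma> ` {1..M} = lab ` \<sigma> ` {1..M}"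
    unfolding image_image by (rule image_cong) (use slots in auto)
  ultimately have L4: "card (lab' ` (S \<union> {h, v}) - lab' ` ?\<sigma> ` {1..M}) = l" using lab(4) by simp
  have S1: "finite (S \<union> {h, v})" "?\<sigma> ` {1..M} \<subseteq> S \<union> {h, v}" "?R \<subseteq> (S \<union> {h, v}) \<times> (S \<union> {h, v})"
    using S zS by auto
  show ?thesis
    unfolding tracks_def by (intro conjI exI[of _ lab'] L3 ballI impI f S1 L1 L2 L4)
qed

text \<open>A negative marker joins the two old ends and opens a new component with two ends:
  \<open>\<mu>\<close> identifies the labels of the joined ends, and \<open>h\<close> and
  \<open>v\<close> share a fresh label \<open>N\<close>.\<close>

lemma tracks_turnback:
  assumes t: "tracks M \<sigma> R S f l" and z: "1 \<le> z" "Suc z \<le> M" and new: "h \<notin> S" "v \<notin> S" "h \<noteq> v"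
  shows "tracks M (\<sigma>(z := h, Suc z := v)) (R \<union> {(\<sigma> z, \<sigma> (Suc z)), (h, v)}) (S \<union> {h, v})
    (turnback z f) (if f z = Suc z then Suc l else l)"
proof -
  obtain lab :: "'a \<Rightarrow> nat" where f: "slot_matching M f" and S: "finite S" "\<sigma> ` {1..M} \<subseteq> S" "R \<subseteq> S \<times> S"
    and lab: "\<And>x y. (x, y) \<in> R \<Longrightarrow> lab x = lab y"
      "\<And>x y. x \<in> S \<Longrightarrow> y \<in> S \<Longrightarrow> lab x = lab y \<Longrightarrow> (x, y) \<in> linked R"
      "\<And>a b. a \<in> {1..M} \<Longrightarrow> b \<in> {1..M} \<Longrightarrow> lab (\<sigma> a) = lab (\<sigma> b) \<longleftrightarrow> b = a \<or> b = f a"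
      "card (lab ` S - lab ` \<sigma> ` {1..M}) = l"
    using t unfolding tracks_def by blast
  note inv = slot_matching_invol[OF f]
  let ?\<sigma> = "\<sigma>(z := h, Suc z := v)" and ?R = "R \<union> {(\<sigma> z, \<sigma> (Suc z)), (h, v)}"
  obtain N where N: "N \<notin> lab ` S" using ex_new_if_finite[OF infinite_UNIV_nat] S(1) by blast
  define \<mu> where "\<mu> t = (if t = lab (\<sigma> (Suc z)) then lab (\<sigma> z) else t)" for t
  define lab' where "lab' x = (if x = h \<or> x = v then N else \<mu> (lab x))" for x
  have \<sigma>S: "a \<in> {1..M} \<Longrightarrow> \<sigma> a \<in> S" for a using S by auto
  have zM: "z \<in> {1..M}" "Suc z \<in> {1..M}" using z by auto
  have zS: "\<sigma> z \<in> S" "\<sigma> (Suc z) \<in> S" using \<sigma>S zM by auto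
  have old: "x \<in> S \<Longrightarrow> lab' x = \<mu> (lab x)" for x using new by (auto simp: lab'_def)
  have hv: "lab' h = N" "lab' v = N" by (auto simp: lab'_def)
  have \<mu>: "x \<in> S \<Longrightarrow> \<mu> (lab x) \<noteq> N" for x using N zS by (auto simp: \<mu>_def)
  have L1: "\<forall>x y. (x, y) \<in> ?R \<longrightarrow> lab' x = lab' y"
    using lab(1) S(3) old hv zS by (auto simp: \<mu>_def)
  have L2: "(x, y) \<in> linked ?R" if xy: "x \<in> S \<union> {h, v}" "y \<in> S \<union> {h, v}" "lab' x = lab' y" for x y
  proof (cases "x \<in> S")
    case True
    then have y: "y \<in> S" using xy hv \<mu> old by auto
    have lift: "lab u = lab u' \<Longrightarrow> u \<in> S \<Longrightarrow> u' \<in> S \<Longrightarrow> (u, u') \<in> linked ?R" for u u'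
      using lab(2)[of u u'] by (intro linked_mono[of R ?R]) auto
    have z': "(\<sigma> z, \<sigma> (Suc z)) \<in> linked ?R" by (intro linked_base) auto
    have "\<mu> (lab x) = \<mu> (lab y)" using xy True y old by simp
    then consider "lab x = lab y" | "lab x = lab (\<sigma> (Suc z))" "lab y = lab (\<sigma> z)"
      | "lab x = lab (\<sigma> z)" "lab y = lab (\<sigma> (Suc z))"
      by (auto simp: \<mu>_def split: if_splits)
    then show ?thesis
      using lift[of x y] lift[of x "\<sigma> z"] lift[of x "\<sigma> (Suc z)"] lift[of y "\<sigma> z"] lift[of y "\<sigma> (Suc z)"]
        True y zS z' by cases (meson linked_trans linked_sym)+
  next
    case False
    then have "x \<in> {h, v}" using xy by auto
    moreover from this have "lab' y = N" using xy hv by auto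
    then have "y \<in> {h, v}" using \<mu>[of y] old[of y] xy by auto
    moreover have "(h, v) \<in> linked ?R" by (intro linked_base) auto
    ultimately show ?thesis using linked_sym[of h v ?R] by auto
  qed
  have L3: "lab' (?\<sigma> a) = lab' (?\<sigma> b) \<longleftrightarrow> b = a \<or> b = turnback z f a"
    if ab: "a \<in> {1..M}" "b \<in> {1..M}" for a b
  proof -
    have zl: "lab' (?\<sigma> c) = (if c = z \<or> c = Suc z then N else \<mu> (lab (\<sigma> c)))" if "c \<in> {1..M}" for c
      using that hv old \<sigma>S by auto
    show ?thesis
    proof (cases "a = z \<or> a = Suc z"; cases "b = z \<or> b = Suc z")
      assume "a = z \<or> a = Suc z" "b = z \<or> b = Suc z"
      then show ?thesis unfolding zl[OF ab(1)] zl[OF ab(2)] by auto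
    next
      assume "a = z \<or> a = Suc z" "\<not> (b = z \<or> b = Suc z)"
      then show ?thesis
        using \<mu>[OF \<sigma>S[OF ab(2)]] unfolding zl[OF ab(1)] zl[OF ab(2)] by auto
    next
      assume "\<not> (a = z \<or> a = Suc z)" "b = z \<or> b = Suc z"
      moreover from this have "b \<noteq> turnback z f a"
        using slot_matching_invol[OF slot_matching_turnback[OF f z], of a] by (metis turnback_simps(1,2))
      ultimately show ?thesis
        using \<mu>[OF \<sigma>S[OF ab(1)]] unfolding zl[OF ab(1)] zl[OF ab(2)] by auto
    next
      assume False: "\<not> (a = z \<or> a = Suc z)" "\<not> (b = z \<or> b = Suc z)"
      have e: "lab (\<sigma> c) = lab (\<sigma> z) \<longleftrightarrow> f c = z" "lab (\<sigma> c) = lab (\<sigma> (Suc z)) \<longleftrightarrow> f c = Suc z"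
        if "c \<in> {1..M}" "c \<noteq> z" "c \<noteq> Suc z" for c
        using lab(3)[OF that(1) zM(1)] lab(3)[OF that(1) zM(2)] that by auto
      have g: "f c = z \<longleftrightarrow> c = f z" "f c = Suc z \<longleftrightarrow> c = f (Suc z)" for c using inv by metis+
      have \<mu>z: "\<mu> t = lab (\<sigma> z) \<longleftrightarrow> t = lab (\<sigma> (Suc z)) \<or> t = lab (\<sigma> z)" for t
        by (simp add: \<mu>_def)
      have e': "\<mu> (lab (\<sigma> c)) = lab (\<sigma> z) \<longleftrightarrow> f c = Suc z \<or> f c = z"
        if "c \<in> {1..M}" "c \<noteq> z" "c \<noteq> Suc z" for c
        using e[OF that] unfolding \<mu>z by blast
      have "\<mu> (lab (\<sigma> a)) = \<mu> (lab (\<sigma> b)) \<longleftrightarrow> b = a \<or> b = bypass z f (f a)"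
      proof (cases "f a = z \<or> f a = Suc z")
        case True
        then have "\<mu> (lab (\<sigma> a)) = lab (\<sigma> z)" using e'[OF ab(1)] False by auto
        then have "\<mu> (lab (\<sigma> a)) = \<mu> (lab (\<sigma> b)) \<longleftrightarrow> f b = Suc z \<or> f b = z"
          using e'[OF ab(2)] False by auto
        also have "\<dots> \<longleftrightarrow> b = a \<or> b = bypass z f (f a)"
          using True unfolding g by (auto simp: bypass_def inv)
        finally show ?thesis .
      next
        case False': False
        then have "lab (\<sigma> a) \<noteq> lab (\<sigma> z)" "lab (\<sigma> a) \<noteq> lab (\<sigma> (Suc z))"
          using e[OF ab(1)] False by auto
        then have "\<mu> (lab (\<sigma> a)) = \<mu> (lab (\<sigma> b)) \<longleftrightarrow> lab (\<sigma> a) = lab (\<sigma> b)"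
          by (auto simp: \<mu>_def)
        then show ?thesis using lab(3)[OF ab] False' by (simp add: bypass_def)
      qed
      then show ?thesis using False unfolding zl[OF ab(1)] zl[OF ab(2)] by simp
    qed
  qed
  \<comment> \<open>A component closes exactly when the two joined slots were partners: their common
    label then disappears from the slots. Otherwise the merged label is still seen at slot
    \<open>f z\<close>.\<close>
  have L4: "card (lab' ` (S \<union> {h, v}) - lab' ` ?\<sigma> ` {1..M}) = (if f z = Suc z then Suc l else l)"
  proof -
    let ?A = "{1..M} - {z, Suc z}"
    have S': "lab' ` (S \<union> {h, v}) = insert N (\<mu> ` lab ` S)"
      using old hv by (auto simp: image_Un image_image)
    have "?\<sigma> ` {1..M} = {h, v} \<union> \<sigma> ` ?A" using zM by auto
    then have \<sigma>': "lab' ` ?\<sigma> ` {1..M} = insert N (\<mu> ` lab ` \<sigma> ` ?A)"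
      using old hv \<sigma>S by (auto simp: image_Un image_image)
    have N': "N \<notin> \<mu> ` lab ` S" using \<mu> by auto
    have diff: "lab' ` (S \<union> {h, v}) - lab' ` ?\<sigma> ` {1..M} = \<mu> ` lab ` S - \<mu> ` lab ` \<sigma> ` ?A"
      unfolding S' \<sigma>' using N' by auto
    have \<sigma>z: "lab ` \<sigma> ` {1..M} = {lab (\<sigma> z), lab (\<sigma> (Suc z))} \<union> lab ` \<sigma> ` ?A" using zM by auto
    show ?thesis
    proof (cases "f z = Suc z")
      case True
      then have eq: "lab (\<sigma> (Suc z)) = lab (\<sigma> z)" using lab(3)[OF zM] by simp
      then have id: "\<mu> t = t" for t by (simp add: \<mu>_def)
      have notin: "lab (\<sigma> z) \<notin> lab ` \<sigma> ` ?A"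
      proof
        assume "lab (\<sigma> z) \<in> lab ` \<sigma> ` ?A"
        then obtain c where "c \<in> ?A" "lab (\<sigma> z) = lab (\<sigma> c)"
          unfolding image_image image_iff by blast
        then show False using lab(3)[OF zM(1), of c] True by auto
      qed
      have "\<mu> ` lab ` S - \<mu> ` lab ` \<sigma> ` ?A = insert (lab (\<sigma> z)) (lab ` S - lab ` \<sigma> ` {1..M})"
        unfolding \<sigma>z id using eq notin zS by auto
      then show ?thesis
        unfolding diff using lab(4) S(1) True zM(1) by simp
    next
      case False
      then have ne: "lab (\<sigma> (Suc z)) \<noteq> lab (\<sigma> z)" using lab(3)[OF zM] by auto
      have fz: "f z \<in> ?A" using False zM slot_matching_in[OF f, of z] slot_matching_fix[OF f, of z] by auto
      have "lab (\<sigma> z) = lab (\<sigma> (f z))" using lab(3)[OF zM(1), of "f z"] fz by auto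
      then have inA: "lab (\<sigma> z) \<in> lab ` \<sigma> ` ?A" using fz by auto
      have 1: "\<mu> ` lab ` S = lab ` S - {lab (\<sigma> (Suc z))}"
        using ne zS by (auto simp: \<mu>_def image_iff)
      have 2: "\<mu> ` lab ` \<sigma> ` ?A = lab ` \<sigma> ` {1..M} - {lab (\<sigma> (Suc z))}"
        unfolding \<sigma>z using ne inA by (auto simp: \<mu>_def)
      have "lab (\<sigma> (Suc z)) \<in> lab ` \<sigma> ` {1..M}" using zM by auto
      then have "\<mu> ` lab ` S - \<mu> ` lab ` \<sigma> ` ?A = lab ` S - lab ` \<sigma> ` {1..M}"
        unfolding 1 2 by auto
      then show ?thesis unfolding diff using lab(4) False by simp
    qed
  qed
  have S1: "finite (S \<union> {h, v})" "?\<sigma> ` {1..M} \<subseteq> S \<union> {h, v}" "?R \<subseteq> (S \<union> {h, v}) \<times> (S \<union> {h, v})"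
    using S zS by auto
  show ?thesis
    unfolding tracks_def
    by (intro conjI exI[of _ lab'] ballI impI slot_matching_turnback[OF f z] S1 L1 L2 L3 L4)
qed

text \<open>The segments met by the slots when rows above \<open>i\<close> and the first \<open>j - 1\<close> crossings
  of row \<open>i\<close> have been smoothed.\<close>

definition front :: "nat \<Rightarrow> nat \<Rightarrow> nat \<Rightarrow> nat \<Rightarrow> nat \<Rightarrow> segment" where
  "front m n i j x =
    (if x \<le> n then V 0 x
     else if 2 * n + m < x then H (2 * n + 2 * m + 1 - x) 0
     else if x < n + i then H (x - n) n
     else if x \<le> 2 * n + i - j then V (i - 1) (2 * n + i - x)
     else if x = 2 * n + i - j + 1 then H i (j - 1)
     else if x \<le> 2 * n + i then V i (2 * n + 1 + i - x)
     else H (x - 2 * n) 0)"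

lemma front_cross:
  assumes "1 \<le> i" "i \<le> m" "1 \<le> j" "j \<le> n"
  shows "front m n i j (crossing_slot n (i, j)) = V (i - 1) j"
    "front m n i j (Suc (crossing_slot n (i, j))) = H i (j - 1)"
    "front m n i (Suc j) = (front m n i j)
      (crossing_slot n (i, j) := H i j, Suc (crossing_slot n (i, j)) := V i j)"
proof -
  define z where "z = crossing_slot n (i, j)"
  have z: "z + j = 2 * n + i" using assms by (simp add: z_def crossing_slot_def)
  show "front m n i j z = V (i - 1) j" "front m n i j (Suc z) = H i (j - 1)"
    using assms z by (auto simp: front_def)
  show "front m n i (Suc j) = (front m n i j)(z := H i j, Suc z := V i j)"
  proof
    fix x
    have e: "2 * n + i - j = z" "2 * n + i - Suc j = z - 1" using z by auto
    consider "x = z" | "x = Suc z" | "x < z" | "Suc z < x" by linarith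
    then show "front m n i (Suc j) x = ((front m n i j)(z := H i j, Suc z := V i j)) x"
    proof cases
      case 1
      then show ?thesis using assms z unfolding front_def e by simp
    next
      case 2
      then have "2 * n + 1 + i - x = j" using z by simp
      then show ?thesis using 2 assms z unfolding front_def e by simp
    next
      case 3
      then have "x \<le> z \<longleftrightarrow> True" "x \<le> z - 1 \<longleftrightarrow> True" by auto
      then show ?thesis using 3 unfolding front_def e by simp
    next
      case 4
      then have "\<not> x \<le> z" "\<not> x \<le> z - 1" "x \<noteq> z + 1" "x \<noteq> z - 1 + 1" by auto
      then show ?thesis using 4 unfolding front_def e by simp
    qed
  qed
qed

text \<open>After the last crossing of row \<open>i\<close> its horizontal end sits at slot
  \<open>n + i\<close>, its final place on the right side.\<close>

lemma front_next_row:
  assumes "1 \<le> i" "i \<le> m"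
  shows "front m n i (Suc n) = front m n (Suc i) 1"
proof
  fix x
  consider "x \<le> n" | "2 * n + m < x" | "n < x" "x < n + i" | "x = n + i" "n < x" "x \<le> 2 * n + m"
    | "n + i < x" "x \<le> 2 * n + i" "x \<le> 2 * n + m" | "2 * n + i < x" "x \<le> 2 * n + m" by linarith
  then show "front m n i (Suc n) x = front m n (Suc i) 1 x"
    using assms by cases (auto simp: front_def)
qed

lemma front_last:
  assumes "p \<in> points m n"
  shows "front m n (Suc m) 1 (boundary_pos m n p) = end_segment m n p"
  using assms by (cases p; cases "fst p") (auto simp: points_def front_def)

definition smoothed :: "kstate \<Rightarrow> (nat \<times> nat) set \<Rightarrow> (segment \<times> segment) set" where
  "smoothed s D = (\<Union>c\<in>D. smoothing (s c) c)"

text \<open>A crossing opens the segments to its right and below it; the others are the first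
  segments at the left and top sides.\<close>

definition reached :: "nat \<Rightarrow> nat \<Rightarrow> (nat \<times> nat) set \<Rightarrow> segment set" where
  "reached m n D = (\<lambda>i. H i 0) ` {1..m} \<union> V 0 ` {1..n} \<union> case_prod H ` D \<union> case_prod V ` D"

lemma tracks_resolve:
  assumes t: "tracks (2 * n + 2 * m) (front m n i j) (smoothed s D) (reached m n D) (fst x) (snd x)"
    and ij: "1 \<le> i" "i \<le> m" "1 \<le> j" "j \<le> n" and D: "(i, j) \<notin> D"
  shows "tracks (2 * n + 2 * m) (front m n i (Suc j)) (smoothed s (insert (i, j) D)) (reached m n (insert (i, j) D))
    (fst (resolve n s (i, j) x)) (snd (resolve n s (i, j) x))"
proof -
  define z where "z = crossing_slot n (i, j)"
  note fr = front_cross[OF ij, folded z_def]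
  have z: "1 \<le> z" "Suc z \<le> 2 * n + 2 * m" using ij by (auto simp: z_def crossing_slot_def)
  have new: "H i j \<notin> reached m n D" "V i j \<notin> reached m n D" "H i j \<noteq> V i j"
    using ij D by (auto simp: reached_def)
  have S: "reached m n (insert (i, j) D) = reached m n D \<union> {H i j, V i j}"
    by (auto simp: reached_def)
  have R: "smoothed s (insert (i, j) D) = smoothed s D \<union> smoothing (s (i, j)) (i, j)"
    by (auto simp: smoothed_def)
  show ?thesis
  proof (cases "s (i, j)")
    case Positive
    then show ?thesis
      using tracks_identity[OF t z new] unfolding S R fr by (simp add: resolve_def)
  next
    case Negative
    then show ?thesis
      using tracks_turnback[OF t z new] unfolding S R fr by (simp add: resolve_def Let_def z_def)
  qed
qed

lemma tracks_row:
  assumes t: "tracks (2 * n + 2 * m) (front m n (Suc r) 1) (smoothed s (crossings r n))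
      (reached m n (crossings r n)) (fst x) (snd x)"
    and r: "r < m"
  shows "k \<le> n \<Longrightarrow> tracks (2 * n + 2 * m) (front m n (Suc r) (Suc k))
      (smoothed s (crossings r n \<union> {Suc r} \<times> {1..k})) (reached m n (crossings r n \<union> {Suc r} \<times> {1..k}))
      (fst (fold (resolve n s) (row_crossings k (Suc r)) x)) (snd (fold (resolve n s) (row_crossings k (Suc r)) x))"
proof (induction k)
  case 0
  then show ?case using t by (simp add: row_crossings_def)
next
  case (Suc k)
  have "insert (Suc r, Suc k) (crossings r n \<union> {Suc r} \<times> {1..k}) = crossings r n \<union> {Suc r} \<times> {1..Suc k}"
    by auto
  moreover have "fold (resolve n s) (row_crossings (Suc k) (Suc r)) x
      = resolve n s (Suc r, Suc k) (fold (resolve n s) (row_crossings k (Suc r)) x)"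
    by (simp add: row_crossings_def)
  ultimately show ?case
    using tracks_resolve[OF Suc.IH] Suc.prems r by (simp add: crossings_def)
qed

text \<open>Before any smoothing each first segment occurs at two slots, as a marked point and as a
  strand end of the front; \<open>arcs m n 0 0\<close> is this pairing. Parity separates the labels
  of horizontal and vertical segments.\<close>

lemma tracks_init:
  assumes "m \<le> n"
  shows "tracks (2 * n + 2 * m) (front m n 1 1) {} (reached m n {}) (arcs m n 0 0) 0"
proof -
  define lab where "lab x = (case x of H i j \<Rightarrow> 2 * i | V i j \<Rightarrow> 2 * j + 1)" for x
  let ?M = "2 * n + 2 * m"
  have fr: "front m n 1 1 a = (if a \<le> n then V 0 a else if a \<le> 2 * n then V 0 (2 * n + 1 - a)
      else if a \<le> 2 * n + m then H (a - 2 * n) 0 else H (2 * n + 2 * m + 1 - a) 0)" if "a \<in> {1..?M}" for a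
    using that unfolding front_def by auto
  have mem: "H i 0 \<in> reached m n {} \<longleftrightarrow> i \<in> {1..m}" "V 0 j \<in> reached m n {} \<longleftrightarrow> j \<in> {1..n}" for i j
    by (auto simp: reached_def)
  have in_S: "front m n 1 1 a \<in> reached m n {}" if "a \<in> {1..?M}" for a
    using that unfolding fr[OF that] by (auto simp: mem)
  have inj: "lab x = lab y \<Longrightarrow> x = y" if "x \<in> reached m n {}" "y \<in> reached m n {}" for x y
    using that by (auto simp: reached_def lab_def) presburger+
  have ends: "reached m n {} \<subseteq> front m n 1 1 ` {1..?M}"
  proof
    fix x assume "x \<in> reached m n {}"
    then consider i where "x = H i 0" "i \<in> {1..m}" | j where "x = V 0 j" "j \<in> {1..n}"
      by (auto simp: reached_def)
    then show "x \<in> front m n 1 1 ` {1..?M}"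
    proof cases
      case 1
      then show ?thesis using fr[of "2 * n + i"] by (intro image_eqI[of _ _ "2 * n + i"]) auto
    next
      case 2
      then show ?thesis using fr[of j] by (intro image_eqI[of _ _ j]) auto
    qed
  qed
  have match: "lab (front m n 1 1 a) = lab (front m n 1 1 b) \<longleftrightarrow> b = a \<or> b = arcs m n 0 0 a"
    if ab: "a \<in> {1..?M}" "b \<in> {1..?M}" for a b
  proof -
    have "arcs m n 0 0 a = (if a \<le> 2 * n then 2 * n + 1 - a else 4 * n + 2 * m + 1 - a)"
      using ab assms by (auto simp: arcs_def)
    moreover have "lab (front m n 1 1 a) = lab (front m n 1 1 b) \<longleftrightarrow> front m n 1 1 a = front m n 1 1 b"
      using inj[OF in_S[OF ab(1)] in_S[OF ab(2)]] by auto
    moreover have "front m n 1 1 a = front m n 1 1 b \<longleftrightarrow> b = a \<or> b = (if a \<le> 2 * n then 2 * n + 1 - a else 4 * n + 2 * m + 1 - a)"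
    proof -
      have ab': "1 \<le> a" "a \<le> 2 * n + 2 * m" "1 \<le> b" "b \<le> 2 * n + 2 * m" using ab by auto
      show ?thesis
        unfolding fr[OF ab(1)] fr[OF ab(2)] using ab'
        by (cases "a \<le> n"; cases "a \<le> 2 * n"; cases "a \<le> 2 * n + m"; cases "b \<le> n"; cases "b \<le> 2 * n";
            cases "b \<le> 2 * n + m"; simp; linarith)
    qed
    ultimately show ?thesis by simp
  qed
  have "lab ` reached m n {} - lab ` front m n 1 1 ` {1..?M} = {}" using ends by auto
  then have card: "card (lab ` reached m n {} - lab ` front m n 1 1 ` {1..?M}) = 0"
    by (simp only: card.empty)
  have fin: "finite (reached m n {})" by (simp add: reached_def)
  have sub: "front m n 1 1 ` {1..?M} \<subseteq> reached m n {}" using in_S by blast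
  have "\<forall>x\<in>reached m n {}. \<forall>y\<in>reached m n {}. lab x = lab y \<longrightarrow> (x, y) \<in> linked {}"
    using inj linked_refl by metis
  then show ?thesis
    unfolding tracks_def
    by (intro conjI exI[of _ lab] arcs_init assms fin sub card) (use match in auto)
qed

lemma tracks_rows:
  assumes "m \<le> n" and "x = fold (resolve n s) (lattice_crossings r n) (arcs m n 0 0, 0)"
  shows "r \<le> m \<Longrightarrow> tracks (2 * n + 2 * m) (front m n (Suc r) 1) (smoothed s (crossings r n))
      (reached m n (crossings r n)) (fst x) (snd x)"
  using assms(2)
proof (induction r arbitrary: x)
  case 0
  then show ?case using tracks_init[OF assms(1)]
    by (simp add: lattice_crossings_def crossings_def smoothed_def)
next
  case (Suc r)
  have "crossings r n \<union> {Suc r} \<times> {1..n} = crossings (Suc r) n" by (auto simp: crossings_def)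
  then show ?case
    using tracks_row[OF Suc.IH[OF _ refl], of n] Suc.prems front_next_row[of "Suc r" m n]
    by (simp add: lattice_crossings_Suc)
qed

section \<open>Slot matchings as Catalan states\<close>

definition decode :: "nat \<Rightarrow> nat \<Rightarrow> (nat \<Rightarrow> nat) \<Rightarrow> state" where
  "decode m n f = {{p, p'} | p p'. p \<in> points m n \<and> p' \<in> points m n \<and>
     boundary_pos m n p' = f (boundary_pos m n p)}"

lemma boundary_pos_side:
  "(S, i) \<in> points m n \<Longrightarrow> boundary_pos m n (S, i) \<in> side_slots m n S"
  by (cases S) (auto simp: points_def)

lemma boundary_pos_range: "p \<in> points m n \<Longrightarrow> boundary_pos m n p \<in> {1..2 * n + 2 * m}"
  by (cases p; cases "fst p") (auto simp: points_def)

lemma boundary_pos_inj: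
  "p \<in> points m n \<Longrightarrow> p' \<in> points m n \<Longrightarrow> boundary_pos m n p = boundary_pos m n p' \<Longrightarrow> p = p'"
  by (cases p; cases p'; cases "fst p"; cases "fst p'") (auto simp: points_def)

lemma boundary_pos_surj:
  assumes "x \<in> side_slots m n S"
  obtains i where "(S, i) \<in> points m n" "boundary_pos m n (S, i) = x"
proof (cases S)
  case Top
  then show ?thesis using that[of x] assms by (auto simp: points_def)
next
  case Right
  then show ?thesis using assms by (intro that[of "x - n"]) (auto simp: points_def)
next
  case Bottom
  then show ?thesis using assms by (intro that[of "2 * n + m + 1 - x"]) (auto simp: points_def)
next
  case Left
  then show ?thesis using assms by (intro that[of "2 * n + 2 * m + 1 - x"]) (auto simp: points_def)
qed

lemma side_slots_cover:
  assumes "x \<in> {1..2 * n + 2 * m}"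
  obtains S where "x \<in> side_slots m n S"
proof -
  consider "x \<le> n" | "n < x" "x \<le> n + m" | "n + m < x" "x \<le> 2 * n + m" | "2 * n + m < x" by linarith
  then show thesis
    using that[of Top] that[of Right] that[of Bottom] that[of Left] assms by cases auto
qed

lemma side_slots_disjoint: "x \<in> side_slots m n S \<Longrightarrow> x \<in> side_slots m n S' \<Longrightarrow> S = S'"
  by (cases S; cases S') auto

lemma boundary_pos_image: "boundary_pos m n ` points m n = {1..2 * n + 2 * m}"
proof
  show "{1..2 * n + 2 * m} \<subseteq> boundary_pos m n ` points m n"
  proof
    fix x assume "x \<in> {1..2 * n + 2 * m}"
    then obtain S where "x \<in> side_slots m n S" by (rule side_slots_cover)
    then show "x \<in> boundary_pos m n ` points m n" by (rule boundary_pos_surj) auto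
  qed
qed (use boundary_pos_range in blast)

lemma segments_eq: "reached m n (crossings m n) = segments m n"
proof
  show "segments m n \<subseteq> reached m n (crossings m n)"
  proof
    fix x assume "x \<in> segments m n"
    then consider i j where "x = H i j" "i \<in> {1..m}" "j \<in> {0..n}"
      | i j where "x = V i j" "i \<in> {0..m}" "j \<in> {1..n}"
      by (auto simp: segments_def)
    then show "x \<in> reached m n (crossings m n)"
    proof cases
      case 1
      then show ?thesis by (cases "j = 0") (auto simp: reached_def crossings_def)
    next
      case 2
      then show ?thesis by (cases "i = 0") (auto simp: reached_def crossings_def)
    qed
  qed
qed (auto simp: reached_def crossings_def segments_def)

lemma K_state_trace:
  assumes mn: "m \<le> n" and x: "x = fold (resolve n s) (lattice_crossings m n) (arcs m n 0 0, 0)"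
  shows "slot_matching (2 * n + 2 * m) (fst x)" "K_state m n s = decode m n (fst x)"
    "card (closed_components m n s) = snd x"
proof -
  let ?M = "2 * n + 2 * m" and ?\<sigma> = "front m n (Suc m) 1" and ?S = "segments m n"
  define R where "R = joins m n s"
  have "tracks ?M ?\<sigma> R ?S (fst x) (snd x)"
    using tracks_rows[OF mn x order_refl] by (simp add: segments_eq smoothed_def joins_def R_def)
  then obtain lab :: "segment \<Rightarrow> nat" where f: "slot_matching ?M (fst x)" and S: "finite ?S" "?\<sigma> ` {1..?M} \<subseteq> ?S"
    and lab: "\<forall>x y. (x, y) \<in> R \<longrightarrow> lab x = lab y"
      "\<forall>x\<in>?S. \<forall>y\<in>?S. lab x = lab y \<longrightarrow> (x, y) \<in> linked R"
      "\<forall>a\<in>{1..?M}. \<forall>b\<in>{1..?M}. lab (?\<sigma> a) = lab (?\<sigma> b) \<longleftrightarrow> b = a \<or> b = fst x a"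
      "card (lab ` ?S - lab ` ?\<sigma> ` {1..?M}) = snd x"
    unfolding tracks_def by blast
  show "slot_matching ?M (fst x)" by fact
  \<comment> \<open>The labelling is constant on components and separates them, so connectedness
    becomes equality of labels.\<close>
  have conn: "(u, v) \<in> connected_segments m n s \<longleftrightarrow> u \<in> ?S \<and> v \<in> ?S \<and> lab u = lab v" for u v
    using lab(1,2) linked_label[of R lab u v]
    unfolding connected_segments_def R_def[symmetric] linked_def by blast
  have ends: "end_segment m n p = ?\<sigma> (boundary_pos m n p)" if "p \<in> points m n" for p
    using front_last[OF that] by simp
  have endS: "end_segment m n p \<in> ?S" if "p \<in> points m n" for p
    using ends[OF that] boundary_pos_range[OF that] S(2) by auto
  have "(p \<noteq> p' \<and> (end_segment m n p, end_segment m n p') \<in> connected_segments m n s)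
      \<longleftrightarrow> boundary_pos m n p' = fst x (boundary_pos m n p)" if p: "p \<in> points m n" "p' \<in> points m n" for p p'
  proof -
    have "lab (?\<sigma> (boundary_pos m n p)) = lab (?\<sigma> (boundary_pos m n p'))
      \<longleftrightarrow> boundary_pos m n p' = boundary_pos m n p \<or> boundary_pos m n p' = fst x (boundary_pos m n p)"
      using lab(3) boundary_pos_range[OF p(1)] boundary_pos_range[OF p(2)] by blast
    moreover have "p = p' \<longleftrightarrow> boundary_pos m n p' = boundary_pos m n p"
      using boundary_pos_inj[OF p] by auto
    moreover have "fst x (boundary_pos m n p) \<noteq> boundary_pos m n p"
      using slot_matching_fix[OF f] boundary_pos_range[OF p(1)] by blast
    ultimately show ?thesis
      unfolding conn using endS[OF p(1)] endS[OF p(2)] unfolding ends[OF p(1)] ends[OF p(2)] by auto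
  qed
  then show "K_state m n s = decode m n (fst x)"
    unfolding K_state_def decode_def by blast
  let ?T = "lab ` ?S - lab ` ?\<sigma> ` {1..?M}"
  have e_image: "end_segment m n ` points m n = ?\<sigma> ` {1..?M}"
    unfolding boundary_pos_image[symmetric] image_image by (rule image_cong) (simp_all add: ends)
  have cls: "connected_segments m n s `` {u} = {v \<in> ?S. lab v = lab u}" if "u \<in> ?S" for u
    using that conn by auto
  \<comment> \<open>Closed components correspond to the labels that occur at no slot, and these are
    counted by \<open>snd x\<close>.\<close>
  have "closed_components m n s = (\<lambda>t. {v \<in> ?S. lab v = t}) ` ?T"
  proof (intro set_eqI iffI)
    fix X assume "X \<in> closed_components m n s"
    then obtain u where u: "u \<in> ?S" "X = {v \<in> ?S. lab v = lab u}" and X: "X \<inter> ?\<sigma> ` {1..?M} = {}"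
      unfolding closed_components_def quotient_def e_image using cls by auto
    have "lab u \<notin> lab ` ?\<sigma> ` {1..?M}"
    proof
      assume "lab u \<in> lab ` ?\<sigma> ` {1..?M}"
      then obtain y where "y \<in> ?\<sigma> ` {1..?M}" "lab u = lab y" by blast
      then show False using u X S(2) by auto
    qed
    then show "X \<in> (\<lambda>t. {v \<in> ?S. lab v = t}) ` ?T" using u by auto
  next
    fix X assume "X \<in> (\<lambda>t. {v \<in> ?S. lab v = t}) ` ?T"
    then obtain u where u: "u \<in> ?S" "X = {v \<in> ?S. lab v = lab u}" "lab u \<notin> lab ` ?\<sigma> ` {1..?M}"
      by blast
    have "X \<inter> ?\<sigma> ` {1..?M} = {}"
    proof (rule equals0I)
      fix y assume "y \<in> X \<inter> ?\<sigma> ` {1..?M}"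
      then have "lab u = lab y" "y \<in> ?\<sigma> ` {1..?M}" using u(2) by auto
      then show False using u(3) by (metis imageI)
    qed
    moreover have "X \<in> ?S // connected_segments m n s"
      unfolding quotient_def using u cls by blast
    ultimately show "X \<in> closed_components m n s"
      unfolding closed_components_def e_image by blast
  qed
  moreover have "inj_on (\<lambda>t. {v \<in> ?S. lab v = t}) ?T"
    by (rule inj_onI) blast
  ultimately show "card (closed_components m n s) = snd x"
    using lab(4) by (simp add: card_image)
qed

lemma decode_cong:
  assumes "\<And>x. x \<in> {1..2 * n + 2 * m} \<Longrightarrow> f x = g x"
  shows "decode m n f = decode m n g"
proof -
  have "f (boundary_pos m n p) = g (boundary_pos m n p)" if "p \<in> points m n" for p
    using assms boundary_pos_range[OF that] .
  then show ?thesis unfolding decode_def by (intro Collect_cong) (metis (no_types))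
qed

lemma decode_Cat:
  assumes f: "slot_matching (2 * n + 2 * m) f"
  shows "decode m n f \<in> Cat m n"
proof -
  note inv = slot_matching_invol[OF f]
  have arc: "boundary_pos m n p' = f (boundary_pos m n p)" "p \<in> points m n" "p' \<in> points m n"
    if arc: "{p, p'} \<in> decode m n f" for p p'
  proof -
    obtain u u' where u: "{p, p'} = {u, u'}" "u \<in> points m n" "u' \<in> points m n"
        "boundary_pos m n u' = f (boundary_pos m n u)" using arc unfolding decode_def by blast
    then have "p = u \<and> p' = u' \<or> p = u' \<and> p' = u" by (auto simp: doubleton_eq_iff)
    then show "boundary_pos m n p' = f (boundary_pos m n p)" "p \<in> points m n" "p' \<in> points m n"
      using u inv by auto
  qed
  have "card a = 2" "a \<subseteq> points m n" if "a \<in> decode m n f" for a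
  proof -
    from that obtain p p' where a: "a = {p, p'}" "p \<in> points m n" "p' \<in> points m n"
      "boundary_pos m n p' = f (boundary_pos m n p)" unfolding decode_def by blast
    then have "p \<noteq> p'" using slot_matching_fix[OF f] boundary_pos_range[OF a(2)] by metis
    then show "card a = 2" "a \<subseteq> points m n" using a by auto
  qed
  moreover have "\<exists>!a. a \<in> decode m n f \<and> p \<in> a" if p: "p \<in> points m n" for p
  proof -
    have "f (boundary_pos m n p) \<in> {1..2 * n + 2 * m}"
      using slot_matching_in[OF f boundary_pos_range[OF p]] .
    then obtain p' where p': "p' \<in> points m n" "boundary_pos m n p' = f (boundary_pos m n p)"
      unfolding boundary_pos_image[symmetric] by auto
    show ?thesis
    proof
      show "{p, p'} \<in> decode m n f \<and> p \<in> {p, p'}" using p p' unfolding decode_def by blast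
      fix a assume a: "a \<in> decode m n f \<and> p \<in> a"
      then obtain u u' where u: "a = {u, u'}" "u \<in> points m n" "u' \<in> points m n"
        "boundary_pos m n u' = f (boundary_pos m n u)" unfolding decode_def by blast
      then consider "p = u" | "p = u'" using a by auto
      then show "a = {p, p'}"
      proof cases
        case 1
        then have "u' = p'" using boundary_pos_inj[OF u(3) p'(1)] u p' by simp
        then show ?thesis using 1 u by simp
      next
        case 2
        then have "boundary_pos m n u = f (boundary_pos m n p)" using u inv by simp
        then have "u = p'" using boundary_pos_inj[OF u(2) p'(1)] p' by simp
        then show ?thesis using 2 u by auto
      qed
    qed
  qed
  ultimately have "perfect_matching m n (decode m n f)"
    unfolding perfect_matching_def by blast
  moreover have "noncrossing m n (decode m n f)"
    unfolding noncrossing_def using arc(1) slot_matching_nc[OF f] by metis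
  ultimately show ?thesis by (simp add: Cat_def)
qed

lemma decode_has_return:
  assumes f: "slot_matching (2 * n + 2 * m) f" and "slot_return m n f"
  shows "has_return (decode m n f)"
proof -
  obtain S x where x: "x \<in> side_slots m n S" "f x \<in> side_slots m n S"
    using assms(2) unfolding slot_return_def by blast
  obtain i where i: "(S, i) \<in> points m n" "boundary_pos m n (S, i) = x" using x(1) by (rule boundary_pos_surj)
  obtain j where j: "(S, j) \<in> points m n" "boundary_pos m n (S, j) = f x" using x(2) by (rule boundary_pos_surj)
  have "{(S, i), (S, j)} \<in> decode m n f" unfolding decode_def using i j by blast
  then have "{(S, i), (S, j)} \<in> arcs_joining S S (decode m n f)" by (simp add: arcs_joining_def)
  then show ?thesis unfolding has_return_def by blast
qed

section \<open>Coefficients of the lattice crossing\<close>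

lemma marker_sum:
  "int (num_markers m n Positive s) - int (num_markers m n Negative s) = (\<Sum>c\<in>crossings m n. marker_sign (s c))"
proof -
  have fin: "finite (crossings m n)" by (simp add: crossings_def)
  have "(\<Sum>c\<in>crossings m n. marker_sign (s c))
      = (\<Sum>c\<in>crossings m n. (if s c = Positive then 1 else 0) - (if s c = Negative then 1 else 0 :: int))"
    by (rule sum.cong) (use marker.exhaust in \<open>auto simp: marker_sign_def\<close>)
  also have "\<dots> = int (num_markers m n Positive s) - int (num_markers m n Negative s)"
    unfolding num_markers_def sum_subtractf using fin by (simp add: sum.If_cases Int_def)
  finally show ?thesis by simp
qed

lemma lookup_sum_scaled:
  "Poly_Mapping.lookup (\<Sum>x\<in>A. scaled (c x) (D x)) C = (\<Sum>x\<in>A. c x * (if D x = C then 1 else 0))"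
  by (simp add: lookup_sum scaled_def lookup_single when_def if_distrib cong: if_cong)

lemma lookup_lattice_crossing:
  assumes "m \<le> n"
  shows "Poly_Mapping.lookup (lattice_crossing m n) C =
    transfer (sweep n 0 m) (arcs m n 0 0) (\<lambda>g. if decode m n g = C then 1 else 0)"
proof -
  let ?x = "\<lambda>s. fold (resolve n s) (lattice_crossings m n) (arcs m n 0 0, 0)"
  have "Poly_Mapping.lookup (lattice_crossing m n) C =
    (\<Sum>s\<in>kauffman_states m n. A_pow (\<Sum>c\<in>crossings m n. marker_sign (s c)) * loop_value ^ snd (?x s) *
      (if decode m n (fst (?x s)) = C then 1 else 0))"
    unfolding lattice_crossing_def lookup_sum_scaled marker_sum loop_value_def[symmetric]
      K_state_trace(2)[OF assms refl] K_state_trace(3)[OF assms refl] ..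
  also have "\<dots> = loop_value ^ 0 * transfer (map (crossing_slot n) (lattice_crossings m n)) (arcs m n 0 0)
      (\<lambda>g. if decode m n g = C then 1 else 0)"
    unfolding transfer_state_sum[OF distinct_lattice_crossings] set_lattice_crossings kauffman_states_def ..
  finally show ?thesis by (simp add: map_slot_lattice)
qed

section \<open>Catalan states without returns\<close>

text \<open>Needed for uniqueness in \<open>T_state\<close>, where an arbitrary Catalan state must
  be compared with \<open>arcs\<close>.\<close>

lemma Cat_decode:
  assumes C: "C \<in> Cat m n"
  obtains f where "slot_matching (2 * n + 2 * m) f" "decode m n f = C"
proof -
  let ?M = "2 * n + 2 * m" and ?P = "points m n" and ?b = "boundary_pos m n"
  have sub: "\<And>a. a \<in> C \<Longrightarrow> a \<subseteq> ?P \<and> card a = 2" and ex1: "\<And>p. p \<in> ?P \<Longrightarrow> \<exists>!a. a \<in> C \<and> p \<in> a"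
    and nc: "noncrossing m n C"
    using C unfolding Cat_def perfect_matching_def by auto
  have "\<exists>p'. {p, p'} \<in> C \<and> p' \<in> ?P \<and> p' \<noteq> p" if p: "p \<in> ?P" for p
  proof -
    obtain a where a: "a \<in> C" "p \<in> a" using ex1[OF p] by blast
    then obtain u v where "a = {u, v}" "u \<noteq> v" using sub[OF a(1)] by (auto simp: card_2_iff)
    moreover from this have "a = {v, u}" "u \<in> ?P" "v \<in> ?P" using sub[OF a(1)] by auto
    moreover have "p = u \<or> p = v" using a calculation by auto
    ultimately show ?thesis using a(1) by metis
  qed
  then obtain r where r: "\<And>p. p \<in> ?P \<Longrightarrow> {p, r p} \<in> C \<and> r p \<in> ?P \<and> r p \<noteq> p" by metis
  have rr: "r (r p) = p" if p: "p \<in> ?P" for p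
  proof -
    have rp: "r p \<in> ?P" using r[OF p] by blast
    have "{r p, r (r p)} = {p, r p}" using ex1[OF rp] r[OF p] r[OF rp] by blast
    then show ?thesis using r[OF rp] by (auto simp: doubleton_eq_iff)
  qed
  define pt where "pt = inv_into ?P ?b"
  have inj: "inj_on ?b ?P" using boundary_pos_inj by (auto intro: inj_onI)
  have pt: "pt x \<in> ?P" "?b (pt x) = x" if "x \<in> {1..?M}" for x
    using that unfolding pt_def boundary_pos_image[symmetric]
    by (rule inv_into_into, rule f_inv_into_f)
  have ptb: "pt (?b p) = p" if "p \<in> ?P" for p
    unfolding pt_def by (rule inv_into_f_f[OF inj that])
  define f where "f x = (if x \<in> {1..?M} then ?b (r (pt x)) else x)" for x
  have fin: "f x \<in> {1..?M}" if "x \<in> {1..?M}" for x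
    using that r[OF pt(1)[OF that]] boundary_pos_range unfolding f_def by auto
  have fb: "f (?b p) = ?b (r p)" if "p \<in> ?P" for p
    using ptb[OF that] boundary_pos_range[OF that] by (simp add: f_def)
  have ff: "f (f x) = x" for x
  proof (cases "x \<in> {1..?M}")
    case True
    then have "f (f x) = ?b (r (r (pt x)))"
      using fb r[OF pt(1)[OF True]] by (simp add: f_def)
    then show ?thesis using rr[OF pt(1)[OF True]] pt(2)[OF True] by simp
  qed (auto simp: f_def)
  have ne: "f x \<noteq> x \<longleftrightarrow> x \<in> {1..?M}" for x
  proof (cases "x \<in> {1..?M}")
    case True
    have "r (pt x) \<noteq> pt x" "r (pt x) \<in> ?P" using r[OF pt(1)[OF True]] by auto
    then have "?b (r (pt x)) \<noteq> ?b (pt x)" using boundary_pos_inj pt(1)[OF True] by blast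
    then show ?thesis using True pt(2)[OF True] by (simp add: f_def)
  qed (auto simp: f_def)
  have "\<not> (a < b \<and> b < f a \<and> f a < f b)" for a b
  proof
    assume ab: "a < b \<and> b < f a \<and> f a < f b"
    then have M: "a \<in> {1..?M}" "b \<in> {1..?M}" using ne[of a] ne[of b] by auto
    have "{pt a, r (pt a)} \<in> C" "{pt b, r (pt b)} \<in> C" using r pt M by auto
    moreover have "?b (pt a) = a" "?b (pt b) = b" "?b (r (pt a)) = f a" "?b (r (pt b)) = f b"
      using pt M by (auto simp: f_def)
    ultimately show False using nc ab unfolding noncrossing_def by metis
  qed
  then have "slot_matching ?M f" unfolding slot_matching_def using ff ne by blast
  moreover have "decode m n f = C"
  proof (intro set_eqI iffI)
    fix a assume "a \<in> decode m n f"
    then obtain p p' where p: "a = {p, p'}" "p \<in> ?P" "p' \<in> ?P" "?b p' = f (?b p)"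
      unfolding decode_def by blast
    then have "p' = r p" using fb[OF p(2)] r[OF p(2)] boundary_pos_inj by metis
    then show "a \<in> C" using r[OF p(2)] p(1) by simp
  next
    fix a assume a: "a \<in> C"
    then obtain p where p: "p \<in> a" "p \<in> ?P" using sub[OF a] by (metis card.empty equals0I subsetD zero_neq_numeral)
    have "a = {p, r p}" using ex1[OF p(2)] r[OF p(2)] a p(1) by blast
    then show "a \<in> decode m n f" unfolding decode_def using r[OF p(2)] p(2) fb[OF p(2), symmetric] by blast
  qed
  ultimately show thesis by (rule that)
qed

text \<open>For two different sides each such arc has exactly one end on \<open>S\<close>, so arcs
  can be counted by these ends.\<close>

lemma card_arcs_joining:
  assumes f: "slot_matching (2 * n + 2 * m) f" and S: "S \<noteq> S'"
  shows "card (arcs_joining S S' (decode m n f)) = card {x \<in> side_slots m n S. f x \<in> side_slots m n S'}"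
proof -
  let ?b = "boundary_pos m n" and ?X = "{p \<in> points m n. fst p = S \<and> f (boundary_pos m n p) \<in> side_slots m n S'}"
  define r where "r p = (THE p'. p' \<in> points m n \<and> ?b p' = f (?b p))" for p
  note inv = slot_matching_invol[OF f]
  have r: "r p \<in> points m n" "?b (r p) = f (?b p)" if p: "p \<in> points m n" for p
  proof -
    have "f (?b p) \<in> ?b ` points m n"
      using slot_matching_in[OF f boundary_pos_range[OF p]] unfolding boundary_pos_image .
    then have "\<exists>!p'. p' \<in> points m n \<and> ?b p' = f (?b p)" using boundary_pos_inj by (auto simp: image_iff)
    from theI'[OF this] show "r p \<in> points m n" "?b (r p) = f (?b p)" unfolding r_def by auto
  qed
  have side: "fst p = S \<longleftrightarrow> ?b p \<in> side_slots m n S" if "p \<in> points m n" for p S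
    using boundary_pos_side[of "fst p" "snd p" m n] side_slots_disjoint that by (metis prod.collapse)
  have fst_r: "p \<in> ?X \<Longrightarrow> fst (r p) = S'" for p using r side by auto
  have "arcs_joining S S' (decode m n f) = (\<lambda>p. {p, r p}) ` ?X"
  proof (intro set_eqI iffI)
    fix a assume "a \<in> arcs_joining S S' (decode m n f)"
    then obtain p p' where p: "a = {p, p'}" "p \<in> points m n" "p' \<in> points m n" "?b p' = f (?b p)"
      and s: "{fst p, fst p'} = {S, S'}" unfolding arcs_joining_def decode_def by auto
    have p': "p' = r p" "p = r p'"
      using p r[OF p(2)] r[OF p(3)] boundary_pos_inj inv by metis+
    from s consider "fst p = S" "fst p' = S'" | "fst p' = S" "fst p = S'" by (auto simp: doubleton_eq_iff)
    then show "a \<in> (\<lambda>p. {p, r p}) ` ?X"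
    proof cases
      case 1
      then have "p \<in> ?X" using p side by auto
      then show ?thesis using p(1) p'(1) by blast
    next
      case 2
      have "f (?b p') = ?b p" using p(4) inv by simp
      then have "p' \<in> ?X" using p 2 side by auto
      moreover have "a = {p', r p'}" using p(1) p'(2) by auto
      ultimately show ?thesis by blast
    qed
  next
    fix a assume "a \<in> (\<lambda>p. {p, r p}) ` ?X"
    then obtain p where p: "a = {p, r p}" "p \<in> ?X" by blast
    have "a \<in> decode m n f" using p r[of p] unfolding decode_def by blast
    then show "a \<in> arcs_joining S S' (decode m n f)"
      using p fst_r[OF p(2)] by (simp add: arcs_joining_def)
  qed
  moreover have "inj_on (\<lambda>p. {p, r p}) ?X"
  proof (rule inj_onI)
    fix p q assume pq: "p \<in> ?X" "q \<in> ?X" "{p, r p} = {q, r q}"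
    then have "p = q \<or> p = r q" by (auto simp: doubleton_eq_iff)
    then show "p = q" using pq(1) fst_r[OF pq(2)] S by auto
  qed
  ultimately have "card (arcs_joining S S' (decode m n f)) = card ?X" by (simp add: card_image)
  also have "\<dots> = card (?b ` ?X)"
    by (rule card_image[symmetric]) (use boundary_pos_inj in \<open>auto intro!: inj_onI\<close>)
  also have "?b ` ?X = {x \<in> side_slots m n S. f x \<in> side_slots m n S'}"
  proof (intro set_eqI iffI)
    fix x assume "x \<in> {x \<in> side_slots m n S. f x \<in> side_slots m n S'}"
    then obtain i where "(S, i) \<in> points m n" "?b (S, i) = x" "f x \<in> side_slots m n S'"
      using boundary_pos_surj[of x m n S] by auto
    then show "x \<in> ?b ` ?X" by (intro image_eqI[of _ _ "(S, i)"]) auto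
  qed (use side in auto)
  finally show ?thesis .
qed

lemma arcs_joining_commute: "arcs_joining S S' C = arcs_joining S' S C"
  by (simp add: arcs_joining_def insert_commute)

lemma has_return_decode:
  assumes f: "slot_matching (2 * n + 2 * m) f" and "has_return (decode m n f)"
  shows "slot_return m n f"
proof -
  obtain S a where "a \<in> arcs_joining S S (decode m n f)" using assms(2) unfolding has_return_def by blast
  then obtain p p' where p: "p \<in> points m n" "p' \<in> points m n" "boundary_pos m n p' = f (boundary_pos m n p)"
    "fst p = S" "fst p' = S" unfolding arcs_joining_def decode_def by auto
  then have "boundary_pos m n p \<in> side_slots m n S" "boundary_pos m n p' \<in> side_slots m n S"
    using boundary_pos_side[of S "snd p"] boundary_pos_side[of S "snd p'"] by (metis prod.collapse)+
  then show ?thesis unfolding slot_return_def using p(3) by metis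
qed

section \<open>Rigidity of return-free matchings\<close>

lemma down_closed_interval:
  fixes D :: "nat set"
  assumes "D \<subseteq> {a<..b}" "\<And>x u. x \<in> D \<Longrightarrow> a < u \<Longrightarrow> u < x \<Longrightarrow> u \<in> D"
  shows "D = {a<..a + card D}"
proof (cases "D = {}")
  case False
  have fin: "finite D" using assms(1) finite_subset by blast
  have "D = {a<..Max D}"
    using assms(2)[OF Max_in[OF fin False]] Max_in[OF fin False] Max_ge[OF fin] assms(1)
    by (auto simp: less_le) (metis le_neq_implies_less less_le)
  moreover from this have "card D = Max D - a" by (metis card_greaterThanAtMost)
  moreover have "a < Max D" using Max_in[OF fin False] assms(1) by auto
  ultimately show ?thesis by simp
qed simp

lemma up_closed_interval:
  fixes D :: "nat set"
  assumes "D \<subseteq> {a<..b}" "\<And>x u. x \<in> D \<Longrightarrow> x < u \<Longrightarrow> u \<le> b \<Longrightarrow> u \<in> D"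
  shows "D = {b - card D<..b}"
proof (cases "D = {}")
  case False
  have fin: "finite D" using assms(1) finite_subset by blast
  have m: "Min D \<in> D" "a < Min D" "Min D \<le> b" using Min_in[OF fin False] assms(1) by auto
  have D: "D = {Min D..b}"
    using assms(2)[OF m(1)] m Min_le[OF fin] assms(1) by (auto simp: less_le) (metis le_neq_implies_less less_le)
  then have "card D = Suc b - Min D" by (metis card_atLeastAtMost)
  then have "Min D = Suc (b - card D)" using m by simp
  with D show ?thesis by (metis atLeastSucAtMost_greaterThanAtMost)
qed simp

text \<open>The map drops by at least one at each step, and \<open>h\<close> values for
  \<open>h\<close> arguments leave no slack.\<close>

lemma strictly_decreasing_interval:
  fixes g :: "nat \<Rightarrow> nat"
  assumes "\<And>x. a < x \<Longrightarrow> x \<le> a + h \<Longrightarrow> b < g x \<and> g x \<le> b + h"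
    and dec: "\<And>x y. a < x \<Longrightarrow> x < y \<Longrightarrow> y \<le> a + h \<Longrightarrow> g y < g x"
    and x: "a < x" "x \<le> a + h"
  shows "g x + x = a + b + h + 1"
proof -
  have step: "x + d \<le> a + h \<Longrightarrow> g (x + d) + d \<le> g x" if "a < x" for x d
  proof (induction d)
    case (Suc d)
    then show ?case using dec[of "x + d" "x + Suc d"] that by simp
  qed simp
  have "g x + (x - Suc a) \<le> g (Suc a)" using step[of "Suc a" "x - Suc a"] x by simp
  moreover have "g (a + h) + (a + h - x) \<le> g x" using step[of x "a + h - x"] x by simp
  moreover have "g (Suc a) \<le> b + h" "b < g (a + h)" using assms(1) x by auto
  ultimately show ?thesis using x by linarith
qed

lemma arc_inside:
  assumes f: "slot_matching M f" "f x = y" "x < u" "u < y"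
  shows "x < f u" "f u < y"
proof -
  have "f u \<noteq> x" "f u \<noteq> y" using assms slot_matching_invol[OF f(1), of u] slot_matching_invol[OF f(1), of x] by auto
  then show "x < f u" "f u < y"
    using slot_matching_nc[OF f(1), of "f u" x] slot_matching_nc[OF f(1), of x u] assms
      slot_matching_invol[OF f(1), of u] by auto
qed

lemma arc_outside:
  assumes f: "slot_matching M f" "f x = y" "x < y" "u < x \<or> y < u"
  shows "f u < x \<or> y < f u"
proof (rule ccontr)
  assume *: "\<not> (f u < x \<or> y < f u)"
  have "f u \<noteq> x" "f u \<noteq> y" using assms slot_matching_invol[OF f(1), of u] slot_matching_invol[OF f(1), of x] by auto
  then have "x < f u" "f u < y" using * by auto
  from arc_inside[OF f(1,2) this] show False using assms(4) slot_matching_invol[OF f(1)] by simp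
qed

text \<open>\<open>f\<close> exchanges the slots strictly inside the arc on the two sides of the
  border after \<open>B\<close>, so there are equally many on each side.\<close>

lemma inner_corner:
  assumes f: "slot_matching M f" "f x = y" and B: "x \<le> B" "B < y"
    and lo: "\<And>u. x < u \<Longrightarrow> u \<le> B \<Longrightarrow> B < f u" and hi: "\<And>u. B < u \<Longrightarrow> u < y \<Longrightarrow> f u \<le> B"
  shows "x + y = 2 * B + 1"
proof -
  have "bij_betw f {x<..B} {B<..<y}"
    by (rule bij_betw_byWitness[where f' = f])
      (use arc_inside[OF f] B lo hi slot_matching_invol[OF f(1)] in auto)
  then have "B - x = y - Suc B" by (auto dest: bij_betw_same_card)
  then show ?thesis using B by simp
qed

text \<open>The same count for the slots outside the arc, at the border between \<open>M\<close> and
  1.\<close>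

lemma outer_corner:
  assumes f: "slot_matching M f" "f x = y" and B: "1 \<le> x" "x < y" "y \<le> M"
    and lo: "\<And>u. 1 \<le> u \<Longrightarrow> u < x \<Longrightarrow> y < f u" and hi: "\<And>u. y < u \<Longrightarrow> u \<le> M \<Longrightarrow> f u < x"
  shows "x + y = M + 1"
proof -
  have "f u \<in> {1..M}" if "u \<in> {1..M}" for u using slot_matching_in[OF f(1) that] .
  then have "bij_betw f {1..<x} {y<..M}"
    by (intro bij_betw_byWitness[where f' = f])
      (use B lo hi slot_matching_invol[OF f(1)] in \<open>fastforce+\<close>)
  then have "x - 1 = M - y" by (auto dest: bij_betw_same_card)
  then show ?thesis using B by simp
qed

text \<open>The arcs cutting off a corner are nested and occupy an interval of slots that ends at
  the corner, so their number determines them. The top slots left over are joined to the bottom in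
  reversed clockwise order, as noncrossing demands.\<close>

lemma return_free_matching_eq_arcs:
  assumes m: "m = k + l" and n: "n = m + h" and f: "slot_matching (2 * n + 2 * m) f" "\<not> slot_return m n f"
    and lt: "card {x \<in> side_slots m n Top. f x \<in> side_slots m n Left} = k"
    and rb: "card {x \<in> side_slots m n Right. f x \<in> side_slots m n Bottom} = k"
    and tr: "card {x \<in> side_slots m n Top. f x \<in> side_slots m n Right} = l"
    and bl: "card {x \<in> side_slots m n Bottom. f x \<in> side_slots m n Left} = l"
    and x: "x \<in> {1..2 * n + 2 * m}"
  shows "f x = arcs m n l k x"
proof -
  let ?M = "2 * n + 2 * m"
  note inv = slot_matching_invol[OF f(1)]
  have range: "1 \<le> f u \<and> f u \<le> ?M" if "1 \<le> u" "u \<le> ?M" for u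
    using slot_matching_in[OF f(1), of u] that by simp
  have ret: "u \<in> side_slots m n S \<Longrightarrow> f u \<notin> side_slots m n S" for u S
    using f(2) unfolding slot_return_def by blast
  have retT: "1 \<le> u \<Longrightarrow> u \<le> n \<Longrightarrow> n < f u" for u using ret[of u Top] range[of u] by simp
  have retR: "n < u \<Longrightarrow> u \<le> n + m \<Longrightarrow> f u \<le> n \<or> n + m < f u" for u using ret[of u Right] by simp linarith
  have retB: "n + m < u \<Longrightarrow> u \<le> 2 * n + m \<Longrightarrow> f u \<le> n + m \<or> 2 * n + m < f u" for u
    using ret[of u Bottom] by simp linarith
  have retL: "2 * n + m < u \<Longrightarrow> u \<le> ?M \<Longrightarrow> f u \<le> 2 * n + m" for u
    using ret[of u Left] range[of u] by simp
  \<comment> \<open>The first ends of the arcs cutting off the top-left (\<open>D\<close>),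
    top-right (\<open>E\<close>), bottom-right (\<open>G\<close>) and bottom-left (\<open>J\<close>)
    corner.\<close>
  define D where "D = {x \<in> {0<..n}. 2 * n + m < f x}"
  define E where "E = {x \<in> {0<..n}. f x \<le> n + m}"
  define G where "G = {x \<in> {n<..n + m}. n + m < f x \<and> f x \<le> 2 * n + m}"
  define J where "J = {x \<in> {n + m<..2 * n + m}. 2 * n + m < f x}"
  have card: "card D = k" "card E = l" "card G = k" "card J = l"
  proof -
    have "D = {x \<in> side_slots m n Top. f x \<in> side_slots m n Left}" using range by (auto simp: D_def Suc_le_eq)
    then show "card D = k" using lt by simp
    have "E = {x \<in> side_slots m n Top. f x \<in> side_slots m n Right}" using retT by (auto simp: E_def Suc_le_eq)
    then show "card E = l" using tr by simp
    have "G = {x \<in> side_slots m n Right. f x \<in> side_slots m n Bottom}" by (auto simp: G_def Suc_le_eq)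
    then show "card G = k" using rb by simp
    have "J = {x \<in> side_slots m n Bottom. f x \<in> side_slots m n Left}" using range by (auto simp: J_def Suc_le_eq)
    then show "card J = l" using bl by simp
  qed
  have D1: "2 * n + m < f u" if "x \<in> D" "1 \<le> u" "u < x" for x u
  proof -
    have x: "x < f x" "x \<le> n" "2 * n + m < f x" using that(1) by (auto simp: D_def)
    have "f u < x \<or> f x < f u" using arc_outside[OF f(1) refl x(1), of u] that by simp
    then show ?thesis using retT[of u] that x by auto
  qed
  have "D = {0<..0 + card D}"
  proof (rule down_closed_interval[where b = n])
    fix x u assume x: "x \<in> D" and u: "0 < u" "u < x"
    have "2 * n + m < f u" using D1[OF x] u by simp
    moreover have "u \<le> n" using x u by (simp add: D_def)
    ultimately show "u \<in> D" using u by (simp add: D_def)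
  qed (auto simp: D_def)
  then have D: "D = {0<..k}" by (simp add: card)
  have fD: "f x + x = ?M + 1" if "1 \<le> x" "x \<le> k" for x
  proof -
    have x: "x \<in> D" using that D by auto
    then have x': "x \<le> n" "2 * n + m < f x" by (auto simp: D_def)
    have "x + f x = ?M + 1"
    proof (rule outer_corner[OF f(1) refl])
      fix u assume u: "1 \<le> u" "u < x"
      then show "f x < f u"
        using arc_outside[OF f(1) refl, of x u] D1[OF x u] x' by auto
    next
      fix u assume u: "f x < u" "u \<le> ?M"
      then show "f u < x"
        using arc_outside[OF f(1) refl, of x u] retL[of u] x' by auto
    qed (use that x' range[of x] in auto)
    then show ?thesis by simp
  qed
  have "E = {n - card E<..n}"
  proof (rule up_closed_interval[where a = 0])
    fix x u assume x: "x \<in> E" and u: "x < u" "u \<le> n"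
    then have "u < f x" using retT[of x] by (auto simp: E_def)
    then show "u \<in> E" using arc_inside[OF f(1) refl u(1)] x u by (auto simp: E_def)
  qed (auto simp: E_def)
  then have E: "E = {n - l<..n}" by (simp add: card)
  have fE: "f x + x = 2 * n + 1" if "n - l < x" "x \<le> n" for x
  proof -
    have x: "x \<in> E" using that E by auto
    then have x': "1 \<le> x" "f x \<le> n + m" "n < f x" using retT[of x] by (auto simp: E_def)
    have "x + f x = 2 * n + 1"
    proof (rule inner_corner[OF f(1) refl])
      fix u assume "n < u" "u < f x"
      then show "f u \<le> n" using arc_inside[OF f(1) refl, of x u] retR[of u] x' that by auto
    qed (use that x' retT in auto)
    then show ?thesis by simp
  qed
  have "G = {n + m - card G<..n + m}"
  proof (rule up_closed_interval[where a = n])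
    fix x u assume x: "x \<in> G" and u: "x < u" "u \<le> n + m"
    then have "u < f x" by (auto simp: G_def)
    then show "u \<in> G" using arc_inside[OF f(1) refl u(1)] x u retR[of u] by (auto simp: G_def)
  qed (auto simp: G_def)
  then have G: "G = {n + m - k<..n + m}" by (simp add: card)
  have fG: "f x + x = 2 * n + 2 * m + 1" if "n + m - k < x" "x \<le> n + m" for x
  proof -
    have x: "x \<in> G" using that G by auto
    then have x': "n < x" "n + m < f x" "f x \<le> 2 * n + m" by (auto simp: G_def)
    have "x + f x = 2 * (n + m) + 1"
    proof (rule inner_corner[OF f(1) refl])
      fix u assume "x < u" "u \<le> n + m"
      then show "n + m < f u" using arc_inside[OF f(1) refl, of x u] retR[of u] x' that by auto
    next
      fix u assume "n + m < u" "u < f x"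
      then show "f u \<le> n + m" using arc_inside[OF f(1) refl, of x u] retB[of u] x' that by auto
    qed (use that x' in auto)
    then show ?thesis by simp
  qed
  have "J = {2 * n + m - card J<..2 * n + m}"
  proof (rule up_closed_interval[where a = "n + m"])
    fix x u assume x: "x \<in> J" and u: "x < u" "u \<le> 2 * n + m"
    then have "u < f x" by (auto simp: J_def)
    then show "u \<in> J" using arc_inside[OF f(1) refl u(1)] x u retB[of u] by (auto simp: J_def)
  qed (auto simp: J_def)
  then have J: "J = {2 * n + m - l<..2 * n + m}" by (simp add: card)
  have fJ: "f x + x = 4 * n + 2 * m + 1" if "2 * n + m - l < x" "x \<le> 2 * n + m" for x
  proof -
    have x: "x \<in> J" using that J by auto
    then have x': "n + m < x" "2 * n + m < f x" "f x \<le> ?M" using range[of x] by (auto simp: J_def)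
    have "x + f x = 2 * (2 * n + m) + 1"
    proof (rule inner_corner[OF f(1) refl])
      fix u assume "x < u" "u \<le> 2 * n + m"
      then show "2 * n + m < f u" using arc_inside[OF f(1) refl, of x u] retB[of u] x' that by auto
    next
      fix u assume "2 * n + m < u" "u < f x"
      then show "f u \<le> 2 * n + m" using retL[of u] x' by auto
    qed (use that x' in auto)
    then show ?thesis by simp
  qed
  \<comment> \<open>Carries the reflection formula from the first ends of a family of arcs to their
    second ends.\<close>
  have mirror: "f y + y = c" if "\<And>x. a < x \<Longrightarrow> x \<le> b \<Longrightarrow> f x + x = c" "c < b + 1 + y" "y + a < c" for a b c y
  proof -
    have "f (c - y) + (c - y) = c" by (rule that(1)) (use that in auto)
    then have "f (c - y) = y" using that by auto
    then have "f y = c - y" using inv by metis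
    then show ?thesis using that by auto
  qed
  \<comment> \<open>Top slots outside \<open>D\<close> and \<open>E\<close> can only reach bottom
    slots that no corner arc occupies.\<close>
  have TB: "n + m + k < f x \<and> f x \<le> n + m + k + h" if "k < x" "x \<le> k + h" for x
  proof -
    have "x \<notin> D" "x \<notin> E" using that D E m n by auto
    then have fx: "n + m < f x" "f x \<le> 2 * n + m" using that m n by (auto simp: D_def E_def)
    have "\<not> f x \<le> n + m + k"
    proof
      assume "f x \<le> n + m + k"
      then have "f (f x) + f x = ?M + 1"
        using fx m n by (intro mirror[of "n + m - k" "n + m", OF fG]) auto
      then show False using \<open>f x \<le> n + m + k\<close> that inv[of x] m n by simp
    qed
    moreover have "\<not> 2 * n + m - l < f x"
    proof
      assume "2 * n + m - l < f x"
      then have "f (f x) + f x = 4 * n + 2 * m + 1" using fJ fx by simp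
      then show False using fx that inv[of x] m n by simp
    qed
    ultimately show ?thesis using m n by simp
  qed
  have fV: "f x + x = k + (n + m + k) + h + 1" if "k < x" "x \<le> k + h" for x
  proof (rule strictly_decreasing_interval[OF TB _ that])
    fix u v assume uv: "k < u" "u < v" "v \<le> k + h"
    have "f u \<noteq> f v" using uv slot_matching_eq_iff[OF f(1)] by simp
    moreover have "v < f u" using TB[of u] uv m n by simp
    ultimately show "f v < f u" using slot_matching_nc[OF f(1), of u v] uv by simp
  qed
  have k: "l + k \<le> m" "m \<le> n" "n = k + l + h" using m n by auto
  consider "1 \<le> x" "x \<le> k" | "k < x" "x + l \<le> n" | "n < x + l" "x \<le> n" | "n < x" "x \<le> n + l"
    | "n + l < x" "x \<le> n + m" | "n + m < x" "x \<le> n + l + 2 * k" | "n + l + 2 * k < x" "x \<le> 2 * n + k"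
    | "2 * n + k < x" "x \<le> 2 * n + m" | "2 * n + m < x" "x + k \<le> ?M" | "?M < x + k" "x \<le> ?M"
    using x unfolding atLeastAtMost_iff by (metis leI)
  \<comment> \<open>With \<open>x\<close> added, each reflection is a constant sum and the truncated
    subtractions of \<open>arcs\<close> disappear.\<close>
  then have "f x + x = arcs m n l k x + x"
  proof cases
    case 1
    then show ?thesis using fD[of x] by (simp add: arcs_def)
  next
    case 2
    then show ?thesis using fV[of x] m n by (simp add: arcs_def)
  next
    case 3
    then show ?thesis using fE[of x] k by (simp add: arcs_def)
  next
    case 4
    then have "f x + x = 2 * n + 1" using k by (intro mirror[of "n - l" n, OF fE]) auto
    then show ?thesis using 4 k by (simp add: arcs_def)
  next
    case 5
    then show ?thesis using fG[of x] m n by (simp add: arcs_def)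
  next
    case 6
    then have "f x + x = 2 * n + 2 * m + 1" using m n by (intro mirror[of "n + m - k" "n + m", OF fG]) auto
    then show ?thesis using 6 m n by (simp add: arcs_def)
  next
    case 7
    then have "f x + x = k + (n + m + k) + h + 1" using m n by (intro mirror[of k "k + h", OF fV]) auto
    then show ?thesis using 7 m n by (simp add: arcs_def)
  next
    case 8
    then show ?thesis using fJ[of x] m n by (simp add: arcs_def)
  next
    case 9
    then have "f x + x = 4 * n + 2 * m + 1" using m n by (intro mirror[of "2 * n + m - l" "2 * n + m", OF fJ]) auto
    then show ?thesis using 9 m n by (simp add: arcs_def)
  next
    case 10
    have "f y + y = ?M + 1" if "0 < y" "y \<le> k" for y using fD[of y] that by simp
    from mirror[of 0 k, OF this] have "f x + x = ?M + 1" using 10 by simp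
    then show ?thesis using 10 m n by (simp add: arcs_def)
  qed
  then show ?thesis by simp
qed

lemma arcs_counts:
  assumes m: "m = k + l" and n: "n = m + h"
  shows "card {x \<in> side_slots m n Top. arcs m n l k x \<in> side_slots m n Left} = k"
    "card {x \<in> side_slots m n Right. arcs m n l k x \<in> side_slots m n Bottom} = k"
    "card {x \<in> side_slots m n Top. arcs m n l k x \<in> side_slots m n Right} = l"
    "card {x \<in> side_slots m n Bottom. arcs m n l k x \<in> side_slots m n Left} = l"
    "card {x \<in> side_slots m n Top. arcs m n l k x \<in> side_slots m n Bottom} = h"
    "\<not> slot_return m n (arcs m n l k)"
proof -
  have mn: "k \<le> m" "l \<le> m" "m \<le> k + l" "k + l \<le> n" "m \<le> n" using m n by auto
  have T: "arcs m n l k x = (if x \<le> k then 2 * n + 2 * m + 1 - x else if x \<le> n - l then 2 * n + 1 + 2 * k - x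
    else 2 * n + 1 - x)" if "1 \<le> x" "x \<le> n" for x
    using that m n by (simp add: arcs_def)
  have R: "arcs m n l k x = (if x \<le> n + l then 2 * n + 1 - x else 2 * n + 2 * m + 1 - x)" if "n < x" "x \<le> n + m" for x
    using that m n by (simp add: arcs_def)
  have B: "arcs m n l k x = (if x \<le> n + m + k then 2 * n + 2 * m + 1 - x else if x \<le> 2 * n + k then 2 * n + 1 + 2 * k - x
      else 4 * n + 2 * m + 1 - x)" if "n + m < x" "x \<le> 2 * n + m" for x
    using that m n by (simp add: arcs_def)
  have L: "arcs m n l k x = (if x \<le> 2 * n + 2 * m - k then 4 * n + 2 * m + 1 - x else 2 * n + 2 * m + 1 - x)"
    if "2 * n + m < x" "x \<le> 2 * n + 2 * m" for x
    using that m n by (simp add: arcs_def)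
  have "{x \<in> side_slots m n Top. arcs m n l k x \<in> side_slots m n Left} = {1..k}"
    using mn by (auto simp: T split: if_splits)
  then show "card {x \<in> side_slots m n Top. arcs m n l k x \<in> side_slots m n Left} = k" by simp
  have "{x \<in> side_slots m n Right. arcs m n l k x \<in> side_slots m n Bottom} = {n + l<..n + m}"
    using mn by (auto simp: R split: if_splits)
  then show "card {x \<in> side_slots m n Right. arcs m n l k x \<in> side_slots m n Bottom} = k" using m by simp
  have "{x \<in> side_slots m n Top. arcs m n l k x \<in> side_slots m n Right} = {n - l<..n}"
    using mn by (auto simp: T split: if_splits)
  then show "card {x \<in> side_slots m n Top. arcs m n l k x \<in> side_slots m n Right} = l" using m n by simp
  have "{x \<in> side_slots m n Bottom. arcs m n l k x \<in> side_slots m n Left} = {2 * n + k<..2 * n + m}"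
    using mn by (auto simp: B split: if_splits)
  then show "card {x \<in> side_slots m n Bottom. arcs m n l k x \<in> side_slots m n Left} = l" using m by simp
  have "{x \<in> side_slots m n Top. arcs m n l k x \<in> side_slots m n Bottom} = {k<..n - l}"
    using mn by (auto simp: T split: if_splits)
  then show "card {x \<in> side_slots m n Top. arcs m n l k x \<in> side_slots m n Bottom} = h" using m n by simp
  have "arcs m n l k x \<notin> side_slots m n S" if "x \<in> side_slots m n S" for x S
    using that mn by (cases S) (auto simp: T R B L split: if_splits)
  then show "\<not> slot_return m n (arcs m n l k)" unfolding slot_return_def by blast
qed

text \<open>The indices are exchanged: a positive row accounts for a top-right and a left-bottom
  arc, a negative row for a left-top and a right-bottom arc.\<close>

lemma T_state_eq:
  assumes m: "m = k + l" and n: "n = m + h"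
  shows "T_state k l h = decode m n (arcs m n l k)"
  unfolding T_state_def m[symmetric] n[symmetric]
proof (rule the_equality)
  have f: "slot_matching (2 * n + 2 * m) (arcs m n l k)"
    using m n by (intro slot_matching_arcs) auto
  note c = card_arcs_joining[OF f]
  have "\<not> has_return (decode m n (arcs m n l k))" using has_return_decode[OF f] arcs_counts(6)[OF m n] by blast
  then show "decode m n (arcs m n l k) \<in> Cat m n \<and> \<not> has_return (decode m n (arcs m n l k)) \<and>
    card (arcs_joining Left Top (decode m n (arcs m n l k))) = k \<and>
    card (arcs_joining Right Bottom (decode m n (arcs m n l k))) = k \<and>
    card (arcs_joining Top Right (decode m n (arcs m n l k))) = l \<and>
    card (arcs_joining Left Bottom (decode m n (arcs m n l k))) = l \<and>
    card (arcs_joining Top Bottom (decode m n (arcs m n l k))) = h"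
    using decode_Cat[OF f] arcs_counts(1-5)[OF m n]
    by (simp add: arcs_joining_commute[of Left] c del: side_slots.simps)
next
  fix C
  assume C: "C \<in> Cat m n \<and> \<not> has_return C \<and> card (arcs_joining Left Top C) = k \<and>
    card (arcs_joining Right Bottom C) = k \<and> card (arcs_joining Top Right C) = l \<and>
    card (arcs_joining Left Bottom C) = l \<and> card (arcs_joining Top Bottom C) = h"
  obtain f where f: "slot_matching (2 * n + 2 * m) f" "decode m n f = C" using C Cat_decode by blast
  note c = card_arcs_joining[OF f(1), unfolded f(2)]
  have "\<not> slot_return m n f" using C f decode_has_return by blast
  then have "f x = arcs m n l k x" if "x \<in> {1..2 * n + 2 * m}" for x
    using C by (intro return_free_matching_eq_arcs[OF m n f(1) _ _ _ _ _ that])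
      (simp_all add: arcs_joining_commute[of Left] c del: side_slots.simps)
  then show "C = decode m n (arcs m n l k)" using decode_cong f(2) by blast
qed

section \<open>Expansion of the lattice crossing\<close>

theorem theorem3p1:
  fixes m n h :: nat
  assumes "m \<ge> 1" and "n \<ge> 1" and "int h = int n - int m"
  shows "\<exists>Remainder :: skein.
    Poly_Mapping.keys Remainder \<subseteq> {C. realizable m n C \<and> has_return C} \<and>
    lattice_crossing m n =
      (\<Sum>k=0..m. scaled (P_coeff k (m - k) h) (T_state k (m - k) h)) + Remainder"
proof -
  have mn: "m \<le> n" "n = m + h" using assms(3) by auto
  let ?T = "\<Sum>k=0..m. scaled (P_coeff k (m - k) h) (T_state k (m - k) h)"
  define Rem where "Rem = lattice_crossing m n - ?T"
  have T: "T_state k (m - k) h = decode m n (arcs m n (m - k) k)" if "k \<le> m" for k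
    using that mn by (intro T_state_eq) auto
  have lookT: "Poly_Mapping.lookup ?T C
      = (\<Sum>k=0..m. P_coeff k (m - k) h * (if decode m n (arcs m n (m - k) k) = C then 1 else 0))" for C
    unfolding lookup_sum_scaled by (rule sum.cong) (use T in auto)
  have "realizable m n C \<and> has_return C" if C: "C \<in> Poly_Mapping.keys Rem" for C
  proof -
    have ne: "Poly_Mapping.lookup (lattice_crossing m n) C \<noteq> Poly_Mapping.lookup ?T C"
      using C by (simp add: Rem_def in_keys_iff lookup_minus)
    \<comment> \<open>Otherwise the indicator of \<open>C\<close> would vanish on all matchings with
      returns, and \<open>transfer_lattice\<close> would make the two coefficients equal.\<close>
    have ret: "has_return C"
    proof (rule ccontr)
      assume "\<not> has_return C"
      then have "return_free m n (\<lambda>g. if decode m n g = C then 1 else 0)"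
        unfolding return_free_def using decode_has_return by auto
      then show False
        using ne lookup_lattice_crossing[OF mn(1)] transfer_lattice[OF assms(3)] lookT by simp
    qed
    \<comment> \<open>The states in \<open>?T\<close> have no returns, so \<open>C\<close> is none
      of them. Its coefficient in \<open>lattice_crossing m n\<close> is then nonzero, and some
      Kauffman state must produce it.\<close>
    have "decode m n (arcs m n (m - k) k) \<noteq> C" if "k \<le> m" for k
    proof -
      have "slot_matching (2 * n + 2 * m) (arcs m n (m - k) k)"
        using mn that by (intro slot_matching_arcs) auto
      then show ?thesis
        using ret has_return_decode arcs_counts(6)[of m k "m - k" n h] mn that by auto
    qed
    then have "Poly_Mapping.lookup ?T C = 0" unfolding lookT by (intro sum.neutral) auto
    then have "Poly_Mapping.lookup (lattice_crossing m n) C \<noteq> 0" using ne by simp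
    then obtain s where s: "s \<in> kauffman_states m n" "K_state m n s = C"
      unfolding lattice_crossing_def lookup_sum_scaled by (auto elim!: sum.not_neutral_contains_not_neutral split: if_splits)
    have "C \<in> Cat m n"
      using K_state_trace(1,2)[OF mn(1) refl, of s] decode_Cat s(2) by metis
    then show ?thesis using s ret unfolding realizable_def by blast
  qed
  then show ?thesis by (intro exI[of _ Rem]) (auto simp: Rem_def)
qed

end
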